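(* Let $K$ be a field, and let $\varepsilon\ge1$, $l\ge1$, $\alpha$ and $p_1,\dots,p_l$ be integers with $\varepsilon+2\le p_1<\dots<p_l\le\alpha-\varepsilon$. Let $$\mathcal A=\{0,1,\dots,\varepsilon,p_1,\dots,p_l,\alpha-1,\alpha\},$$ and let $S\subseteq\mathbb N^2$ be the semigroup generated by the elements $(a,\alpha-a)$, $a\in\mathcal A$. Then $$\operatorname{reg}K[S]\ \ge\ r(S)\ \ge\ \left[\frac{p_1-2}{\varepsilon}\right]+1 .$$ In particular, if also $\alpha-i\in\mathcal A$ for all $0\le i\le\varepsilon$ and $p_1-\varepsilon-1=\lambda(f_{\mathcal A})$, then $$\operatorname{reg}K[S]=r(S)=\left[\frac{\lambda(f_{\mathcal A})-1}{\varepsilon}\right]+2 .$$ Here $[a]$ denotes the integer part (floor) of $a\in\mathbb R$.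
   Context: $\mathbb N$ denotes the set of non-negative integers. $K[S]\subseteq K[t_1,t_2]$ is the affine semigroup ring spanned over $K$ by the monomials $t_1^{u_1}t_2^{u_2}$ with $(u_1,u_2)\in S$, where $S$ contains $0$; it is graded by $\deg(u_1,u_2)=(u_1+u_2)/\alpha$. Let $\mathfrak m$ be the maximal homogeneous ideal of $K[S]$ and $\mathfrak q=(t_1^\alpha,t_2^\alpha)\subseteq K[S]$ (a minimal reduction of $\mathfrak m$). The reduction number is $r(S)=\min\{r\in\mathbb N : \mathfrak m^{r+1}=\mathfrak q\,\mathfrak m^r\}$. The Castelnuovo-Mumford regularity $\operatorname{reg}K[S]$ is the smallest integer $n$ such that $H^i_{\mathfrak m}(K[S])_{j-i}=0$ for all $i\ge0$ and all $j>n$. $f_{\mathcal A}=\sum_{i\in\mathcal A}t^i$ is the polynomial with coefficients in $\{0,1\}$ and support $\mathcal A$. A gap of $f_{\mathcal A}$ is a set $L=\{i,i+1,\dots,j\}\subseteq\mathbb N\setminus\mathcal A$ with $i\le j$ and $i-1,j+1\in\mathcal A$; its length is its cardinality. $\lambda(f_{\mathcal A})$ denotes the maximal length of a gap of $f_{\mathcal A}$ ($0$ if there is no gap). *)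

theory Defs
  imports
    "HOL-Library.Poly_Mapping"
    "HOL-Library.Product_Plus"
    "HOL-Computational_Algebra.Polynomial"
    "HOL-Algebra.Ideal_Product"
    "HOL-Algebra.Elementary_Groups"
begin

section \<open>Affine semigroup rings in two variables\<close>

text \<open>
  The polynomial ring in \<open>t\<^sub>1, t\<^sub>2\<close> over a field is regarded as a subring of the Laurent polynomial
  ring, i.e. of the finitely supported functions on the integer lattice with convolution as
  product, because the localizations of the semigroup ring live there.
\<close>

type_synonym 'k laurent2 = "(int \<times> int) \<Rightarrow>\<^sub>0 'k"

definition t_monom :: "int \<times> int \<Rightarrow> 'k::field laurent2" where
  "t_monom u = Poly_Mapping.single u 1"

definition gen :: "nat \<Rightarrow> nat \<Rightarrow> int \<times> int" where
  "gen \<alpha> a = (int a, int \<alpha> - int a)"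

inductive_set proj_semigroup :: "nat \<Rightarrow> nat set \<Rightarrow> (int \<times> int) set"
  for \<alpha> :: nat and A :: "nat set" where
  zero: "0 \<in> proj_semigroup \<alpha> A"
| gen: "a \<in> A \<Longrightarrow> gen \<alpha> a \<in> proj_semigroup \<alpha> A"
| add: "u \<in> proj_semigroup \<alpha> A \<Longrightarrow> v \<in> proj_semigroup \<alpha> A \<Longrightarrow> u + v \<in> proj_semigroup \<alpha> A"

definition semigroup_ring :: "(int \<times> int) set \<Rightarrow> 'k::field laurent2 ring" where
  "semigroup_ring S =
     \<lparr>carrier = {f. Poly_Mapping.keys f \<subseteq> S}, monoid.mult = (*), one = 1, zero = 0, add = (+)\<rparr>"

text \<open>The component of degree \<open>d\<close>, where \<open>deg (u\<^sub>1, u\<^sub>2) = (u\<^sub>1 + u\<^sub>2) / \<alpha>\<close>.\<close>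

definition homog_part :: "nat \<Rightarrow> int \<Rightarrow> 'k::field laurent2 set" where
  "homog_part \<alpha> d = {f. \<forall>u\<in>Poly_Mapping.keys f. fst u + snd u = int \<alpha> * d}"

definition max_homog_ideal :: "(int \<times> int) set \<Rightarrow> 'k::field laurent2 set" where
  "max_homog_ideal S = {f. Poly_Mapping.keys f \<subseteq> S - {0}}"

definition min_reduction :: "nat \<Rightarrow> (int \<times> int) set \<Rightarrow> 'k::field laurent2 set" where
  "min_reduction \<alpha> S =
     Idl\<^bsub>semigroup_ring S\<^esub> {t_monom (int \<alpha>, 0), t_monom (0, int \<alpha>)}"


section \<open>Reduction number\<close>

definition reduction_number_wrt :: "('a, 'b) ring_scheme \<Rightarrow> 'a set \<Rightarrow> 'a set \<Rightarrow> nat" where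
  "reduction_number_wrt R q m =
     (LEAST r::nat. m [^]\<^bsub>ideals_set R\<^esub> (r + 1) = q \<cdot>\<^bsub>R\<^esub> (m [^]\<^bsub>ideals_set R\<^esub> r))"

definition reduction_number :: "'k::field itself \<Rightarrow> nat \<Rightarrow> nat set \<Rightarrow> nat" where
  "reduction_number _ \<alpha> A =
     (let S = proj_semigroup \<alpha> A; R = (semigroup_ring S :: 'k laurent2 ring)
      in reduction_number_wrt R (min_reduction \<alpha> S) (max_homog_ideal S))"


section \<open>Local cohomology and regularity\<close>

text \<open>
  Local cohomology is the cohomology of the Cech complex
  \<open>0 \<rightarrow> R \<rightarrow> \<Oplus>\<^sub>a R[1/x\<^sub>a] \<rightarrow> \<Oplus>\<^sub>a\<^sub><\<^sub>b R[1/(x\<^sub>a x\<^sub>b)] \<rightarrow> \<dots>\<close>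
  on a finite family \<open>x\<close> of generators of the supporting ideal.

  The ring \<open>R\<close> (given by its carrier) is a subring of an ambient commutative ring in which the
  elements to be inverted are units (monomials in a Laurent polynomial ring, below).  Hence the
  localization \<open>R[1/f]\<close> is the set of all \<open>g\<close> in the ambient ring with \<open>f ^ n * g \<in> R\<close> for some
  \<open>n\<close>, and all localization maps are inclusions.  A cochain of degree \<open>p\<close> is a family indexed by
  the \<open>p\<close>-element subsets of the index set \<open>I\<close>, extended by zero.
\<close>

definition localization :: "'a::comm_ring_1 set \<Rightarrow> 'a \<Rightarrow> 'a set" where
  "localization R f = {g. \<exists>n::nat. f ^ n * g \<in> R}"

definition cech_cochains ::
  "'a::comm_ring_1 set \<Rightarrow> ('i \<Rightarrow> 'a) \<Rightarrow> 'i set \<Rightarrow> 'a set \<Rightarrow> nat \<Rightarrow> ('i set \<Rightarrow> 'a) set" where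
  \<comment> \<open>\<open>H\<close> is the homogeneous part of the ambient ring in which the components are taken.\<close>
  "cech_cochains R x I H p =
     {c. \<forall>F. if F \<subseteq> I \<and> card F = p then c F \<in> localization R (\<Prod>a\<in>F. x a) \<inter> H else c F = 0}"

definition cech_diff :: "'i::linorder set \<Rightarrow> ('i set \<Rightarrow> 'a::comm_ring_1) \<Rightarrow> ('i set \<Rightarrow> 'a)" where
  "cech_diff I c =
     (\<lambda>F. if F \<subseteq> I then \<Sum>a\<in>F. (-1) ^ card {b\<in>F. b < a} * c (F - {a}) else 0)"

definition cech_cocycles ::
  "'a::comm_ring_1 set \<Rightarrow> ('i::linorder \<Rightarrow> 'a) \<Rightarrow> 'i set \<Rightarrow> 'a set \<Rightarrow> nat \<Rightarrow> ('i set \<Rightarrow> 'a) set" where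
  "cech_cocycles R x I H p = {c \<in> cech_cochains R x I H p. cech_diff I c = (\<lambda>F. 0)}"

definition cech_coboundaries ::
  "'a::comm_ring_1 set \<Rightarrow> ('i::linorder \<Rightarrow> 'a) \<Rightarrow> 'i set \<Rightarrow> 'a set \<Rightarrow> nat \<Rightarrow> ('i set \<Rightarrow> 'a) set" where
  "cech_coboundaries R x I H p =
     (case p of 0 \<Rightarrow> {\<lambda>F. 0} | Suc q \<Rightarrow> cech_diff I ` cech_cochains R x I H q)"

definition cech_cohomology ::
  "'a::comm_ring_1 set \<Rightarrow> ('i::linorder \<Rightarrow> 'a) \<Rightarrow> 'i set \<Rightarrow> 'a set \<Rightarrow> nat \<Rightarrow> ('i set \<Rightarrow> 'a) set monoid"
  where
  "cech_cohomology R x I H p =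
     \<lparr>carrier = cech_cocycles R x I H p, monoid.mult = (\<lambda>c c' F. c F + c' F), one = (\<lambda>F. 0)\<rparr>
       Mod cech_coboundaries R x I H p"

text \<open>
  The degree \<open>d\<close> part of the \<open>p\<close>-th local cohomology of the semigroup ring, supported at the
  maximal homogeneous ideal, which is generated by the monomials with exponents
  \<open>(a, \<alpha> - a)\<close>, \<open>a \<in> A\<close>.
\<close>

definition local_cohomology ::
  "'k::field itself \<Rightarrow> nat \<Rightarrow> nat set \<Rightarrow> nat \<Rightarrow> int \<Rightarrow> (nat set \<Rightarrow> 'k laurent2) set monoid" where
  "local_cohomology _ \<alpha> A p d =
     cech_cohomology (carrier (semigroup_ring (proj_semigroup \<alpha> A)))
       (\<lambda>a. t_monom (gen \<alpha> a)) A (homog_part \<alpha> d) p"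

definition regularity :: "'k::field itself \<Rightarrow> nat \<Rightarrow> nat set \<Rightarrow> int" where
  "regularity K \<alpha> A =
     (LEAST n::int. \<forall>(i::nat) (j::int). j > n \<longrightarrow> trivial_group (local_cohomology K \<alpha> A i (j - int i)))"


section \<open>Gaps of a polynomial\<close>

definition support_poly :: "nat set \<Rightarrow> int poly" where
  "support_poly A = (\<Sum>a\<in>A. Polynomial.monom 1 a)"

definition poly_support :: "'a::zero poly \<Rightarrow> nat set" where
  "poly_support f = {i. Polynomial.coeff f i \<noteq> 0}"

definition is_gap :: "'a::zero poly \<Rightarrow> nat set \<Rightarrow> bool" where
  "is_gap f L \<longleftrightarrow>
     (\<exists>i j. 1 \<le> i \<and> i \<le> j \<and> L = {i..j} \<and> L \<inter> poly_support f = {} \<and>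
        i - 1 \<in> poly_support f \<and> j + 1 \<in> poly_support f)"

definition max_gap :: "'a::zero poly \<Rightarrow> nat" where
  "max_gap f = Max (insert 0 {card L | L. is_gap f L})"

end

theory Submission
  imports Defs "HOL-Library.Set_Algebras"
begin

text \<open>
  The degree \<open>n\<close> part of the semigroup is the \<open>n\<close>-fold sumset \<open>nA\<close>.  The ideals involved are spanned
  by monomials, so the reduction number is the least \<open>r\<close> with \<open>(r + 1)A \<subseteq> rA + {0, \<alpha>}\<close>.  Since
  \<open>0, 1, \<alpha> - 1, \<alpha> \<in> A\<close>, the localization at a nonempty set of generators is cut out by sign conditions
  alone; hence the only local cohomology in degrees \<open>d \<ge> 0\<close> is \<open>H\<^sup>1\<close>, spanned by the holes of \<open>dA\<close> in
  \<open>[0, d\<alpha>]\<close>, and the regularity is the least \<open>n \<ge> 1\<close> for which \<open>nA\<close> has no holes.  In that case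
  \<open>(n + 1)A \<subseteq> nA + {0, \<alpha>}\<close>, which gives \<open>reg \<ge> r\<close>.  Below \<open>p\<^sub>1\<close> the sumset \<open>nA\<close> is just \<open>[0, n\<epsilon>]\<close>, so
  \<open>r\<epsilon> + 1 < p\<^sub>1\<close> would contradict the reduction property.  In the symmetric case \<open>kA\<close> contains an
  interval of length \<open>k\<epsilon>\<close> around each multiple of \<open>\<alpha>\<close>, and \<open>k\<epsilon> \<ge> \<lambda>\<close> suffices for \<open>(k + 1)A\<close> to have no
  holes.
\<close>

section \<open>Iterated sumsets\<close>

primrec sumset :: "nat set \<Rightarrow> nat \<Rightarrow> nat set" where
  "sumset A 0 = {0}"
| "sumset A (Suc n) = {a + s | a s. a \<in> A \<and> s \<in> sumset A n}"

lemma sumset_SucI: "a \<in> A \<Longrightarrow> s \<in> sumset A n \<Longrightarrow> a + s \<in> sumset A (Suc n)"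
  by auto

lemma sumset_one [simp]: "sumset A (Suc 0) = A"
  by auto

lemma sumset_add:
  "s \<in> sumset A m \<Longrightarrow> t \<in> sumset A n \<Longrightarrow> s + t \<in> sumset A (m + n)"
proof (induction m arbitrary: s)
  case (Suc m)
  then obtain a s' where "s = a + s'" "a \<in> A" "s' \<in> sumset A m" by auto
  with Suc sumset_SucI[of a A "s' + t" "m + n"] show ?case by (simp add: add.assoc)
qed simp

lemma sumset_add_split:
  "s \<in> sumset A (m + n) \<Longrightarrow> \<exists>a\<in>sumset A m. \<exists>b\<in>sumset A n. s = a + b"
proof (induction m arbitrary: s)
  case (Suc m)
  then obtain a s' where s: "s = a + s'" "a \<in> A" "s' \<in> sumset A (m + n)" by auto
  with Suc.IH obtain b c where "b \<in> sumset A m" "c \<in> sumset A n" "s' = b + c" by blast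
  with s show ?case by (intro bexI[of _ "a + b"] bexI[of _ c]) auto
qed simp

lemma sumset_le: "A \<subseteq> {..m} \<Longrightarrow> s \<in> sumset A n \<Longrightarrow> s \<le> n * m"
proof (induction n arbitrary: s)
  case (Suc n)
  then obtain a s' where "s = a + s'" "a \<in> A" "s' \<in> sumset A n" by auto
  with Suc show ?case by (force simp: algebra_simps intro: add_mono)
qed simp

text \<open>A sum below \<open>q\<close> has only summands below \<open>q\<close>, and each of those
  is at most \<open>e\<close>.\<close>

lemma sumset_initial:
  assumes "\<And>a. a \<in> A \<Longrightarrow> a < q \<Longrightarrow> a \<le> e" "s \<in> sumset A n" "s < q"
  shows "s \<le> n * e"
  using assms(2,3)
proof (induction n arbitrary: s)
  case (Suc n)
  then obtain a s' where "s = a + s'" "a \<in> A" "s' \<in> sumset A n" by auto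
  with Suc assms(1)[of a] show ?case by (force intro: add_mono)
qed simp

text \<open>Greedy choice: each summand takes \<open>min t e\<close> of what remains.\<close>

lemma sumset_low: "{0..e} \<subseteq> A \<Longrightarrow> t \<le> n * e \<Longrightarrow> t \<in> sumset A n"
proof (induction n arbitrary: t)
  case (Suc n)
  have "t - min t e \<in> sumset A n" by (rule Suc.IH) (use Suc.prems in auto)
  with Suc.prems(1) have "min t e + (t - min t e) \<in> sumset A (Suc n)"
    by (intro sumset_SucI) auto
  then show ?case by simp
qed simp

text \<open>The mirror image of \<open>sumset_low\<close> under the reflection of \<open>a\<close>
  to \<open>\<alpha> - a\<close>.\<close>

lemma sumset_high:
  assumes "e \<le> \<alpha>" "\<And>i. i \<le> e \<Longrightarrow> \<alpha> - i \<in> A"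
  shows "t \<le> n * e \<Longrightarrow> n * \<alpha> - t \<in> sumset A n"
proof (induction n arbitrary: t)
  case (Suc n)
  define m where "m = min t e"
  have le: "t - m \<le> n * e" using Suc.prems by (auto simp: m_def)
  have mem: "\<alpha> - m + (n * \<alpha> - (t - m)) \<in> sumset A (Suc n)"
    using Suc.IH[OF le] assms by (intro sumset_SucI) (auto simp: m_def)
  \<comment> \<open>These bounds guarantee that none of the natural-number subtractions below is
    truncated.\<close>
  have "n * e \<le> n * \<alpha>" using assms(1) by simp
  moreover have "m \<le> e" "m \<le> t" by (simp_all add: m_def)
  ultimately have "\<alpha> - m + (n * \<alpha> - (t - m)) = Suc n * \<alpha> - t"
    using le assms(1) unfolding mult_Suc by linarith
  with mem show ?case by simp
qed simp

text \<open>Of the \<open>k\<close> summands, \<open>i\<close> are taken near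
  \<open>\<alpha>\<close> and \<open>k - i\<close> near \<open>0\<close>. To the left of
  \<open>i * \<alpha>\<close> only the first group moves away from its extreme value, to the right
  only the second.\<close>

lemma sumset_middle:
  assumes "{0..e} \<subseteq> A" "e \<le> \<alpha>" "\<And>i. i \<le> e \<Longrightarrow> \<alpha> - i \<in> A" "i \<le> k"
    and "i * \<alpha> \<le> w + i * e" "w \<le> i * \<alpha> + (k - i) * e"
  shows "w \<in> sumset A k"
proof (cases "w \<le> i * \<alpha>")
  case True
  have "i * \<alpha> - (i * \<alpha> - w) \<in> sumset A i"
    by (rule sumset_high) (use assms in auto)
  moreover have "0 \<in> sumset A (k - i)" using assms(1) by (intro sumset_low[of e]) auto
  ultimately have "i * \<alpha> - (i * \<alpha> - w) + 0 \<in> sumset A (i + (k - i))" by (rule sumset_add)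
  with True assms(4) show ?thesis by simp
next
  case False
  have "i * \<alpha> - 0 \<in> sumset A i" by (rule sumset_high) (use assms in auto)
  moreover have "w - i * \<alpha> \<in> sumset A (k - i)"
    using assms by (intro sumset_low[of e]) auto
  ultimately have "i * \<alpha> - 0 + (w - i * \<alpha>) \<in> sumset A (i + (k - i))" by (rule sumset_add)
  with False assms(4) show ?thesis by simp
qed

text \<open>The \<open>k\<close>-fold sumset contains intervals of length \<open>k * e\<close> around the multiples of \<open>\<alpha>\<close>; adding
  one more summand from \<open>A\<close> bridges the space between them as soon as \<open>k * e\<close> exceeds all gaps.\<close>

lemma sumset_full_if_gaps_le:
  assumes "{0..e} \<subseteq> A" "e \<le> \<alpha>" "\<And>i. i \<le> e \<Longrightarrow> \<alpha> - i \<in> A" "g \<le> k * e"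
    and gap: "\<And>y. y \<le> \<alpha> \<Longrightarrow> \<exists>a\<in>A. a \<le> y \<and> y \<le> a + g"
  shows "{..Suc k * \<alpha>} \<subseteq> sumset A (Suc k)"
proof
  fix s assume s: "s \<in> {..Suc k * \<alpha>}"
  \<comment> \<open>At the top endpoint the quotient would be \<open>k + 1\<close>, so this point is
    assigned to the last block, with \<open>z = \<alpha>\<close>.\<close>
  define i where "i = (if s = Suc k * \<alpha> then k else s div \<alpha>)"
  define z where "z = s - i * \<alpha>"
  have sz: "s = i * \<alpha> + z" and "z \<le> \<alpha>" and "i \<le> k"
  proof -
    consider "s = Suc k * \<alpha>" | "s < Suc k * \<alpha>" using s by force
    then have "i * \<alpha> \<le> s \<and> s \<le> i * \<alpha> + \<alpha> \<and> i \<le> k"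
    proof cases
      case 2
      then have "s div \<alpha> < Suc k" using less_mult_imp_div_less by blast
      moreover have "s \<le> s div \<alpha> * \<alpha> + \<alpha>"
        using div_mult_mod_eq[of s \<alpha>] 2
        by (metis add_le_cancel_left gr_zeroI less_imp_le_nat mod_less_divisor mult_0_right not_less_zero)
      ultimately show ?thesis using 2 by (auto simp: i_def)
    qed (simp add: i_def)
    then show "s = i * \<alpha> + z" "z \<le> \<alpha>" "i \<le> k" by (auto simp: z_def)
  qed
  \<comment> \<open>The two inequalities say precisely that \<open>s - a\<close> lies in the
    interval around \<open>i * \<alpha>\<close> that \<open>sumset_middle\<close> provides. The
    window for \<open>a\<close> has length \<open>k * e\<close>, at least \<open>g\<close>, so it
    meets \<open>A\<close>; if its upper end exceeds \<open>\<alpha>\<close>, then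
    \<open>\<alpha>\<close> itself lies in it.\<close>
  obtain a where a: "a \<in> A" "a \<le> z + i * e" "z + i * e \<le> a + k * e"
  proof (cases "z + i * e \<le> \<alpha>")
    case True
    with gap[of "z + i * e"] assms(4) that show ?thesis by fastforce
  next
    case False
    moreover have "i * e \<le> k * e" using \<open>i \<le> k\<close> by (rule mult_right_mono) simp
    then have "z + i * e \<le> \<alpha> + k * e" using \<open>z \<le> \<alpha>\<close> by linarith
    ultimately show ?thesis using that[of \<alpha>] assms(3)[of 0] by auto
  qed
  have ie: "i * e \<le> i * \<alpha>" using assms(2) by simp
  have ke: "i * e + (k - i) * e = k * e" using \<open>i \<le> k\<close> by (simp flip: distrib_right)
  have "s - a \<in> sumset A k"
    by (rule sumset_middle[OF assms(1-3) \<open>i \<le> k\<close>]) (use a sz ie ke in linarith)+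
  with a(1) have "a + (s - a) \<in> sumset A (Suc k)" by (rule sumset_SucI)
  moreover have "a + (s - a) = s" using a(2) sz ie by linarith
  ultimately show "s \<in> sumset A (Suc k)" by simp
qed

text \<open>For \<open>n \<ge> 1\<close> the intervals from \<open>0\<close> to
  \<open>n * \<alpha>\<close> and from \<open>\<alpha>\<close> to \<open>(n + 1) * \<alpha>\<close>
  leave no space between them, and they arise by adding the summands \<open>0\<close> and
  \<open>\<alpha>\<close>.\<close>

lemma sumset_full_mono:
  assumes "{..m * \<alpha>} \<subseteq> sumset A m" "0 \<in> A" "\<alpha> \<in> A" "1 \<le> m" "m \<le> n"
  shows "{..n * \<alpha>} \<subseteq> sumset A n"
  using assms(5)
proof (induction n rule: dec_induct)
  case (step n)
  show ?case
  proof
    fix s assume s: "s \<in> {..Suc n * \<alpha>}"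
    show "s \<in> sumset A (Suc n)"
    proof (cases "s \<le> n * \<alpha>")
      case True
      then have "0 + s \<in> sumset A (Suc n)" using step assms(2) by (intro sumset_SucI) auto
      then show ?thesis by simp
    next
      case False
      have "1 * \<alpha> \<le> n * \<alpha>" using assms(4) step.hyps by (intro mult_right_mono) auto
      with False have "\<alpha> \<le> s" by linarith
      moreover have "\<alpha> + (s - \<alpha>) \<in> sumset A (Suc n)"
        using step assms(3) s by (intro sumset_SucI) auto
      ultimately show ?thesis by simp
    qed
  qed
qed (rule assms(1))

section \<open>The graded structure of the semigroup\<close>

text \<open>Coordinates adapted to the grading: degree \<open>n\<close> and first entry
  \<open>s\<close>. Adding points adds both parameters.\<close>

definition pt :: "nat \<Rightarrow> nat \<Rightarrow> nat \<Rightarrow> int \<times> int" where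
  "pt \<alpha> n s = (int s, int n * int \<alpha> - int s)"

lemma pt_add: "pt \<alpha> m s + pt \<alpha> n t = pt \<alpha> (m + n) (s + t)"
  by (simp add: pt_def algebra_simps)

lemma gen_eq_pt: "gen \<alpha> a = pt \<alpha> 1 a"
  by (simp add: gen_def pt_def)

lemma pt_eq_iff: "0 < \<alpha> \<Longrightarrow> pt \<alpha> m s = pt \<alpha> n t \<longleftrightarrow> m = n \<and> s = t"
  by (auto simp: pt_def)

text \<open>The semigroup elements of degree at least \<open>k\<close>; these turn out to be the
  exponents of the \<open>k\<close>-th power of the maximal homogeneous ideal.\<close>

definition semigroup_from :: "nat \<Rightarrow> nat set \<Rightarrow> nat \<Rightarrow> (int \<times> int) set" where
  "semigroup_from \<alpha> A k = {pt \<alpha> n s | n s. k \<le> n \<and> s \<in> sumset A n}"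

lemma pt_in_semigroup_from: "k \<le> n \<Longrightarrow> s \<in> sumset A n \<Longrightarrow> pt \<alpha> n s \<in> semigroup_from \<alpha> A k"
  unfolding semigroup_from_def by blast

lemma pt_sumset_in_semigroup: "s \<in> sumset A n \<Longrightarrow> pt \<alpha> n s \<in> proj_semigroup \<alpha> A"
proof (induction n arbitrary: s)
  case 0
  then show ?case using proj_semigroup.zero by (simp add: pt_def zero_prod_def)
next
  case (Suc n)
  then obtain a s' where "s = a + s'" "a \<in> A" "s' \<in> sumset A n" by auto
  with Suc.IH show ?case
    using proj_semigroup.add[OF proj_semigroup.gen[of a A \<alpha>], of "pt \<alpha> n s'"]
    by (simp add: gen_eq_pt pt_add)
qed

lemma proj_semigroup_eq: "proj_semigroup \<alpha> A = semigroup_from \<alpha> A 0"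
proof (intro equalityI subsetI)
  fix u assume "u \<in> proj_semigroup \<alpha> A"
  then show "u \<in> semigroup_from \<alpha> A 0"
  proof induction
    case zero
    show ?case unfolding semigroup_from_def
      by (auto simp: pt_def zero_prod_def intro!: exI[of _ 0])
  next
    case (gen a)
    then show ?case unfolding semigroup_from_def gen_eq_pt by force
  next
    case (add u v)
    then show ?case unfolding semigroup_from_def by (auto simp: pt_add) (blast intro: sumset_add)
  qed
qed (auto simp: semigroup_from_def pt_sumset_in_semigroup)

lemma pt_in_semigroup_from_iff:
  "0 < \<alpha> \<Longrightarrow> pt \<alpha> n s \<in> semigroup_from \<alpha> A k \<longleftrightarrow> k \<le> n \<and> s \<in> sumset A n"
  by (auto simp: semigroup_from_def pt_eq_iff)

text \<open>A sum of \<open>n \<ge> k + m\<close> generators splits into its first \<open>k\<close>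
  and the remaining \<open>n - k \<ge> m\<close>.\<close>

lemma semigroup_from_add:
  "semigroup_from \<alpha> A k + semigroup_from \<alpha> A m = semigroup_from \<alpha> A (k + m)"
proof (intro equalityI subsetI)
  fix u assume "u \<in> semigroup_from \<alpha> A k + semigroup_from \<alpha> A m"
  then obtain a b i j where "u = pt \<alpha> i a + pt \<alpha> j b" "k \<le> i" "m \<le> j"
    "a \<in> sumset A i" "b \<in> sumset A j"
    unfolding semigroup_from_def by (auto elim!: set_plus_elim)
  then show "u \<in> semigroup_from \<alpha> A (k + m)"
    unfolding semigroup_from_def using sumset_add[of a A i b j]
    by (intro CollectI exI[of _ "i + j"] exI[of _ "a + b"]) (simp add: pt_add)
next
  fix u assume "u \<in> semigroup_from \<alpha> A (k + m)"
  then obtain n s where ns: "u = pt \<alpha> n s" "k + m \<le> n" "s \<in> sumset A n"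
    by (auto simp: semigroup_from_def)
  then have "s \<in> sumset A (k + (n - k))" by simp
  from sumset_add_split[OF this] obtain a b where
    ab: "a \<in> sumset A k" "b \<in> sumset A (n - k)" "s = a + b" by blast
  moreover have "m \<le> n - k" using ns(2) by simp
  ultimately have "u = pt \<alpha> k a + pt \<alpha> (n - k) b" "pt \<alpha> k a \<in> semigroup_from \<alpha> A k"
    "pt \<alpha> (n - k) b \<in> semigroup_from \<alpha> A m"
    using ns by (simp add: pt_add, unfold semigroup_from_def, blast, blast)
  then show "u \<in> semigroup_from \<alpha> A k + semigroup_from \<alpha> A m"
    by (auto intro: set_plus_intro)
qed

section \<open>Monomial subspaces and the reduction number\<close>

text \<open>The rings, ideals and graded localizations below all have this form, so equalities
  between them become equalities of exponent sets.\<close>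

definition monomial_span :: "(int \<times> int) set \<Rightarrow> 'k::field laurent2 set" where
  "monomial_span X = {f. Poly_Mapping.keys f \<subseteq> X}"

lemma keys_t_monom [simp]: "Poly_Mapping.keys (t_monom u :: 'k::field laurent2) = {u}"
  by (simp add: t_monom_def)

lemma t_monom_in_span_iff: "(t_monom u :: 'k::field laurent2) \<in> monomial_span X \<longleftrightarrow> u \<in> X"
  by (simp add: monomial_span_def)

lemma monomial_span_eq_iff:
  "(monomial_span X :: 'k::field laurent2 set) = monomial_span Y \<longleftrightarrow> X = Y"
proof
  assume "(monomial_span X :: 'k laurent2 set) = monomial_span Y"
  then have "(t_monom u :: 'k laurent2) \<in> monomial_span X \<longleftrightarrow> (t_monom u :: 'k laurent2) \<in> monomial_span Y"
    for u by simp
  then show "X = Y" unfolding t_monom_in_span_iff by blast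
qed simp

lemma monomial_span_add:
  "f \<in> monomial_span X \<Longrightarrow> g \<in> monomial_span X \<Longrightarrow> f + g \<in> monomial_span X"
  unfolding monomial_span_def using keys_add[of f g] by blast

lemma monomial_span_uminus: "f \<in> monomial_span X \<Longrightarrow> - f \<in> monomial_span X"
  by (auto simp: monomial_span_def in_keys_iff)

lemma monomial_span_mult:
  "f \<in> monomial_span X \<Longrightarrow> g \<in> monomial_span Y \<Longrightarrow> f * g \<in> monomial_span (X + Y)"
  unfolding monomial_span_def using keys_mult[of f g] by (force simp: set_plus_def)

lemma monomial_span_mono: "X \<subseteq> Y \<Longrightarrow> monomial_span X \<subseteq> monomial_span Y"
  by (auto simp: monomial_span_def)

lemma monomial_span_induct [consumes 1, case_names zero add]:
  assumes "f \<in> monomial_span X" "P 0"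
    and "\<And>u c f. u \<in> X \<Longrightarrow> P f \<Longrightarrow> P (Poly_Mapping.single u c + f)"
  shows "P (f :: 'k::field laurent2)"
proof -
  have "finite F \<Longrightarrow> F \<subseteq> X \<Longrightarrow> Poly_Mapping.keys f \<subseteq> F \<Longrightarrow> P f" for F and f :: "'k laurent2"
  proof (induction F arbitrary: f rule: finite_induct)
    case empty
    then show ?case using assms(2) by simp
  next
    case (insert u F)
    define g where "g = f - Poly_Mapping.single u (Poly_Mapping.lookup f u)"
    have "Poly_Mapping.keys g \<subseteq> F"
      using insert.prems(2)
      by (auto simp: g_def in_keys_iff lookup_minus lookup_single when_def split: if_splits)
    then have "P g" using insert by simp
    then have "P (Poly_Mapping.single u (Poly_Mapping.lookup f u) + g)"
      using insert.prems by (intro assms(3)) auto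
    then show ?case by (simp add: g_def)
  qed
  from this[of "Poly_Mapping.keys f" f] show ?thesis
    using assms(1) by (simp add: monomial_span_def)
qed

lemma carrier_semigroup_ring: "carrier (semigroup_ring S) = monomial_span S"
  by (simp add: semigroup_ring_def monomial_span_def)

text \<open>A single term with exponent \<open>x + y\<close> is a product of a term with exponent
  \<open>x\<close> and a monic one with exponent \<open>y\<close>; sums of such terms give
  everything else.\<close>

lemma ideal_prod_monomial_span:
  "ideal_prod (semigroup_ring S) (monomial_span X) (monomial_span Y)
     = (monomial_span (X + Y) :: 'k::field laurent2 set)"
proof (intro equalityI subsetI)
  fix f :: "'k laurent2"
  assume "f \<in> ideal_prod (semigroup_ring S) (monomial_span X) (monomial_span Y)"
  then show "f \<in> monomial_span (X + Y)"
    by induction (auto simp: semigroup_ring_def intro: monomial_span_mult monomial_span_add)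
next
  fix f :: "'k laurent2"
  let ?P = "ideal_prod (semigroup_ring S) (monomial_span X) (monomial_span Y)"
  assume "f \<in> monomial_span (X + Y)"
  then show "f \<in> ?P"
  proof (induction rule: monomial_span_induct)
    case zero
    have "(0 :: 'k laurent2) \<in> monomial_span X" "(0 :: 'k laurent2) \<in> monomial_span Y"
      by (simp_all add: monomial_span_def)
    from ideal_prod.prod[OF this, of "semigroup_ring S"] show ?case
      by (simp add: semigroup_ring_def)
  next
    case (add u c f)
    then obtain x y where xy: "u = x + y" "x \<in> X" "y \<in> Y" by (auto elim: set_plus_elim)
    then have "Poly_Mapping.single x c \<in> monomial_span X"
      "(Poly_Mapping.single y 1 :: 'k laurent2) \<in> monomial_span Y"
      by (simp_all add: monomial_span_def)
    from ideal_prod.prod[OF this, of "semigroup_ring S"]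
    have "Poly_Mapping.single u c \<in> ?P" by (simp add: semigroup_ring_def mult_single xy)
    from ideal_prod.sum[OF this add.IH] show ?case by (simp add: semigroup_ring_def)
  qed
qed

lemma cring_semigroup_ring:
  assumes "0 \<in> S" "S + S \<subseteq> S"
  shows "cring (semigroup_ring S :: 'k::field laurent2 ring)"
proof -
  have mult: "f * g \<in> monomial_span S" if "f \<in> monomial_span S" "g \<in> monomial_span S"
    for f g :: "'k laurent2"
    using monomial_span_mult[OF that] monomial_span_mono[OF assms(2)] by blast
  have one: "(1 :: 'k laurent2) \<in> monomial_span S" using assms(1) by (simp add: monomial_span_def)
  have zero: "(0 :: 'k laurent2) \<in> monomial_span S" by (simp add: monomial_span_def)
  show ?thesis
  proof (rule cringI)
    show "abelian_group (semigroup_ring S :: 'k laurent2 ring)"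
    proof (rule abelian_groupI)
      fix f :: "'k laurent2" assume "f \<in> carrier (semigroup_ring S)"
      then show "\<exists>g\<in>carrier (semigroup_ring S). g \<oplus>\<^bsub>semigroup_ring S\<^esub> f = \<zero>\<^bsub>semigroup_ring S\<^esub>"
        unfolding carrier_semigroup_ring
        by (intro bexI[of _ "- f"] monomial_span_uminus) (auto simp: semigroup_ring_def)
    qed (auto simp: carrier_semigroup_ring semigroup_ring_def add_ac zero intro: monomial_span_add
        simp flip: monomial_span_def)
    show "comm_monoid (semigroup_ring S :: 'k laurent2 ring)"
      by (rule comm_monoidI)
        (auto simp: carrier_semigroup_ring semigroup_ring_def mult_ac one intro: mult
          simp flip: monomial_span_def)
  qed (auto simp: semigroup_ring_def algebra_simps)
qed

text \<open>Absorption of ring elements is the condition \<open>S + X \<subseteq> X\<close> on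
  exponents.\<close>

lemma ideal_monomial_span:
  assumes "0 \<in> S" "S + S \<subseteq> S" "X \<subseteq> S" "S + X \<subseteq> X"
  shows "ideal (monomial_span X) (semigroup_ring S :: 'k::field laurent2 ring)"
proof -
  interpret cring "semigroup_ring S :: 'k laurent2 ring"
    by (rule cring_semigroup_ring[OF assms(1,2)])
  have mult: "f * g \<in> monomial_span X" if "f \<in> monomial_span S" "g \<in> monomial_span X"
    for f g :: "'k laurent2"
    using monomial_span_mult[OF that] monomial_span_mono[OF assms(4)] by blast
  show ?thesis
  proof (rule idealI)
    show "subgroup (monomial_span X) (add_monoid (semigroup_ring S :: 'k laurent2 ring))"
    proof (rule add.subgroupI)
      show "monomial_span X \<subseteq> carrier (semigroup_ring S :: 'k laurent2 ring)"
        unfolding carrier_semigroup_ring by (rule monomial_span_mono) fact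
      show "monomial_span X \<noteq> ({} :: 'k laurent2 set)"
        by (auto simp: monomial_span_def intro: exI[of _ 0])
    next
      fix f :: "'k laurent2" assume f: "f \<in> monomial_span X"
      have "\<ominus>\<^bsub>semigroup_ring S\<^esub> f = - f"
      proof (rule minus_equality)
        show "- f \<oplus>\<^bsub>semigroup_ring S\<^esub> f = \<zero>\<^bsub>semigroup_ring S\<^esub>" by (simp add: semigroup_ring_def)
      qed (use f monomial_span_uminus[OF f] monomial_span_mono[OF assms(3)] in
          \<open>auto simp: carrier_semigroup_ring\<close>)
      then show "\<ominus>\<^bsub>semigroup_ring S\<^esub> f \<in> monomial_span X"
        using f by (simp add: monomial_span_uminus)
    qed (auto simp: semigroup_ring_def intro: monomial_span_add)
    show "ring (semigroup_ring S :: 'k laurent2 ring)" by unfold_locales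
    fix f g :: "'k laurent2"
    assume "f \<in> monomial_span X" "g \<in> carrier (semigroup_ring S)"
    then have "g * f \<in> monomial_span X" by (simp add: carrier_semigroup_ring mult)
    then show "g \<otimes>\<^bsub>semigroup_ring S\<^esub> f \<in> monomial_span X"
      "f \<otimes>\<^bsub>semigroup_ring S\<^esub> g \<in> monomial_span X"
      by (simp_all add: semigroup_ring_def mult.commute)
  qed
qed

text \<open>The exponents \<open>S + X\<close> contain \<open>X\<close> and absorb \<open>S\<close>,
  which bounds the generated ideal from above. Conversely, each term with exponent
  \<open>s + x\<close> is a ring multiple of the generator \<open>t_monom x\<close>.\<close>

lemma genideal_t_monom:
  assumes S: "0 \<in> S" "S + S \<subseteq> S" and X: "X \<subseteq> S"
  shows "Idl\<^bsub>semigroup_ring S\<^esub> (t_monom ` X) = (monomial_span (S + X) :: 'k::field laurent2 set)"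
proof -
  interpret cring "semigroup_ring S :: 'k laurent2 ring"
    by (rule cring_semigroup_ring[OF S])
  have sub: "t_monom ` X \<subseteq> (monomial_span (S + X) :: 'k laurent2 set)"
    using S(1) by (auto simp: t_monom_in_span_iff intro: set_zero_plus2[THEN subsetD])
  have id: "ideal (monomial_span (S + X)) (semigroup_ring S :: 'k laurent2 ring)"
  proof (rule ideal_monomial_span[OF S])
    show "S + X \<subseteq> S" using S(2) X set_plus_mono2[of S S X S] by blast
    show "S + (S + X) \<subseteq> S + X"
      using S(2) set_plus_mono2[of "S + S" S X X] by (simp add: add.assoc)
  qed
  show ?thesis
  proof (rule equalityI)
    show "Idl\<^bsub>semigroup_ring S\<^esub> (t_monom ` X) \<subseteq> (monomial_span (S + X) :: 'k laurent2 set)"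
      using id sub by (rule genideal_minimal)
    have gen: "t_monom ` X \<subseteq> (Idl\<^bsub>semigroup_ring S\<^esub> (t_monom ` X) :: 'k laurent2 set)"
      by (rule genideal_self) (use X in \<open>auto simp: carrier_semigroup_ring t_monom_in_span_iff\<close>)
    interpret I: ideal "Idl\<^bsub>semigroup_ring S\<^esub> (t_monom ` X)" "semigroup_ring S :: 'k laurent2 ring"
      by (rule genideal_ideal) (use X in \<open>auto simp: carrier_semigroup_ring t_monom_in_span_iff\<close>)
    show "monomial_span (S + X) \<subseteq> (Idl\<^bsub>semigroup_ring S\<^esub> (t_monom ` X) :: 'k laurent2 set)"
    proof
      fix f :: "'k laurent2" assume "f \<in> monomial_span (S + X)"
      then show "f \<in> Idl\<^bsub>semigroup_ring S\<^esub> (t_monom ` X)"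
      proof (induction rule: monomial_span_induct)
        case zero
        show ?case using I.zero_closed by (simp add: semigroup_ring_def)
      next
        case (add u c f)
        then obtain s x where u: "u = s + x" "s \<in> S" "x \<in> X" by (auto elim: set_plus_elim)
        have "Poly_Mapping.single s c \<otimes>\<^bsub>semigroup_ring S\<^esub> t_monom x
            \<in> Idl\<^bsub>semigroup_ring S\<^esub> (t_monom ` X)"
          using gen u by (intro I.I_l_closed) (auto simp: carrier_semigroup_ring monomial_span_def)
        then have "Poly_Mapping.single u c \<in> Idl\<^bsub>semigroup_ring S\<^esub> (t_monom ` X)"
          by (simp add: semigroup_ring_def t_monom_def mult_single u)
        from I.a_closed[OF this add.IH] show ?case by (simp add: semigroup_ring_def)
      qed
    qed
  qed
qed

section \<open>The maximal ideal, its powers and the reduction ideal as monomial spans\<close>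

lemma max_homog_ideal_eq:
  assumes "0 < \<alpha>"
  shows "max_homog_ideal (proj_semigroup \<alpha> A) = (monomial_span (semigroup_from \<alpha> A 1) :: 'k::field laurent2 set)"
proof -
  have 0: "0 = pt \<alpha> 0 0" by (simp add: pt_def zero_prod_def)
  have "proj_semigroup \<alpha> A - {0} = semigroup_from \<alpha> A 1"
  proof (intro equalityI subsetI)
    fix u assume "u \<in> proj_semigroup \<alpha> A - {0}"
    then obtain n s where u: "u = pt \<alpha> n s" "s \<in> sumset A n" "u \<noteq> 0"
      by (auto simp: proj_semigroup_eq semigroup_from_def)
    then have "n \<noteq> 0" using 0 by (intro notI) auto
    with u show "u \<in> semigroup_from \<alpha> A 1" using assms by (simp add: pt_in_semigroup_from_iff)
  next
    fix u assume "u \<in> semigroup_from \<alpha> A 1"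
    then show "u \<in> proj_semigroup \<alpha> A - {0}"
      unfolding 0 proj_semigroup_eq using assms by (auto simp: semigroup_from_def pt_eq_iff)
  qed
  then show ?thesis by (simp add: max_homog_ideal_def monomial_span_def)
qed

lemma semigroup_from_closed:
  "0 \<in> semigroup_from \<alpha> A 0" "semigroup_from \<alpha> A 0 + semigroup_from \<alpha> A 0 \<subseteq> semigroup_from \<alpha> A 0"
  using proj_semigroup.zero[of \<alpha> A] by (simp_all add: semigroup_from_add proj_semigroup_eq)

lemma min_reduction_eq:
  assumes "0 \<in> A" "\<alpha> \<in> A"
  shows "min_reduction \<alpha> (proj_semigroup \<alpha> A)
    = (monomial_span (semigroup_from \<alpha> A 0 + pt \<alpha> 1 ` {0, \<alpha>}) :: 'k::field laurent2 set)"
proof -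
  have "{t_monom (int \<alpha>, 0), t_monom (0, int \<alpha>)} = (t_monom ` (pt \<alpha> 1 ` {0, \<alpha>}) :: 'k laurent2 set)"
    by (auto simp: pt_def)
  moreover have "pt \<alpha> 1 ` {0, \<alpha>} \<subseteq> semigroup_from \<alpha> A 0"
    using assms by (auto intro!: pt_in_semigroup_from)
  ultimately show ?thesis
    unfolding min_reduction_def proj_semigroup_eq
    by (simp only: genideal_t_monom[OF semigroup_from_closed])
qed

lemma max_homog_ideal_power:
  assumes "0 < \<alpha>"
  shows "max_homog_ideal (proj_semigroup \<alpha> A) [^]\<^bsub>ideals_set (semigroup_ring (proj_semigroup \<alpha> A))\<^esub> n
    = (monomial_span (semigroup_from \<alpha> A n) :: 'k::field laurent2 set)"
  unfolding nat_pow_def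
proof (induction n)
  case 0
  then show ?case by (simp add: ideals_set_def carrier_semigroup_ring proj_semigroup_eq)
next
  case (Suc n)
  then show ?case
    by (simp add: ideals_set_def max_homog_ideal_eq[OF assms] ideal_prod_monomial_span
        semigroup_from_add)
qed

text \<open>Comparing the parts of degree \<open>r + 1\<close> gives the sumset condition. It
  suffices for the higher degrees too: split off the surplus summands and apply it to the other
  \<open>r + 1\<close>.\<close>

lemma semigroup_from_reduction_iff:
  assumes "0 < \<alpha>" "0 \<in> A" "\<alpha> \<in> A"
  shows "semigroup_from \<alpha> A (Suc r) = pt \<alpha> 1 ` {0, \<alpha>} + semigroup_from \<alpha> A r
    \<longleftrightarrow> sumset A (Suc r) \<subseteq> {0, \<alpha>} + sumset A r"
proof
  assume eq: "semigroup_from \<alpha> A (Suc r) = pt \<alpha> 1 ` {0, \<alpha>} + semigroup_from \<alpha> A r"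
  show "sumset A (Suc r) \<subseteq> {0, \<alpha>} + sumset A r"
  proof
    fix s assume "s \<in> sumset A (Suc r)"
    then have "pt \<alpha> (Suc r) s \<in> semigroup_from \<alpha> A (Suc r)"
      unfolding pt_in_semigroup_from_iff[OF assms(1)] by blast
    then obtain x v where "pt \<alpha> (Suc r) s = x + v" "x \<in> pt \<alpha> 1 ` {0, \<alpha>}" "v \<in> semigroup_from \<alpha> A r"
      unfolding eq by (rule set_plus_elim)
    then obtain g n t where "g \<in> {0, \<alpha>}" "t \<in> sumset A n"
      "pt \<alpha> (Suc r) s = pt \<alpha> 1 g + pt \<alpha> n t"
      unfolding semigroup_from_def by blast
    moreover from this(3) have "n = r" "s = g + t"
      by (simp_all add: pt_add pt_eq_iff[OF assms(1)])
    ultimately show "s \<in> {0, \<alpha>} + sumset A r" by (simp only: set_plus_intro)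
  qed
next
  assume sub: "sumset A (Suc r) \<subseteq> {0, \<alpha>} + sumset A r"
  show "semigroup_from \<alpha> A (Suc r) = pt \<alpha> 1 ` {0, \<alpha>} + semigroup_from \<alpha> A r"
  proof
    have "pt \<alpha> 1 ` {0, \<alpha>} \<subseteq> semigroup_from \<alpha> A 1"
      using assms by (auto simp: pt_in_semigroup_from_iff)
    from set_plus_mono2[OF this order.refl, of "semigroup_from \<alpha> A r"]
    show "pt \<alpha> 1 ` {0, \<alpha>} + semigroup_from \<alpha> A r \<subseteq> semigroup_from \<alpha> A (Suc r)"
      unfolding semigroup_from_add by simp
    show "semigroup_from \<alpha> A (Suc r) \<subseteq> pt \<alpha> 1 ` {0, \<alpha>} + semigroup_from \<alpha> A r"
    proof
      fix u assume "u \<in> semigroup_from \<alpha> A (Suc r)"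
      then obtain n s where u: "u = pt \<alpha> n s" "Suc r \<le> n" "s \<in> sumset A n"
        unfolding semigroup_from_def by blast
      define j where "j = n - Suc r"
      have n: "n = Suc r + j" using u by (simp add: j_def)
      from sumset_add_split[OF u(3)[unfolded n]] sub obtain a b where
        "a \<in> {0, \<alpha>} + sumset A r" "b \<in> sumset A j" "s = a + b" by blast
      then obtain g c where g: "g \<in> {0, \<alpha>}" "c \<in> sumset A r" "b \<in> sumset A j" "s = g + (c + b)"
        by (auto elim!: set_plus_elim simp: add.assoc simp del: singleton_iff insert_iff)
      have "u = pt \<alpha> 1 g + pt \<alpha> (r + j) (c + b)" using u g n by (simp add: pt_add)
      moreover have "pt \<alpha> (r + j) (c + b) \<in> semigroup_from \<alpha> A r"
        using assms(1) sumset_add[OF g(2,3)] by (simp add: pt_in_semigroup_from_iff)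
      ultimately show "u \<in> pt \<alpha> 1 ` {0, \<alpha>} + semigroup_from \<alpha> A r"
        using g(1) by (simp only: set_plus_intro imageI)
    qed
  qed
qed

lemma reduction_number_eq:
  assumes "0 < \<alpha>" "0 \<in> A" "\<alpha> \<in> A"
  shows "reduction_number TYPE('k::field) \<alpha> A
    = (LEAST r. sumset A (Suc r) \<subseteq> {0, \<alpha>} + sumset A r)"
proof -
  \<comment> \<open>The ring factor in the reduction ideal is absorbed by the power of the maximal
    ideal.\<close>
  have "semigroup_from \<alpha> A 0 + pt \<alpha> 1 ` {0, \<alpha>} + semigroup_from \<alpha> A r
      = pt \<alpha> 1 ` {0, \<alpha>} + semigroup_from \<alpha> A r" for r
    by (metis add.assoc add.commute semigroup_from_add add_0)
  then show ?thesis
    unfolding reduction_number_def reduction_number_wrt_def Let_def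
      max_homog_ideal_power[OF assms(1)] min_reduction_eq[OF assms(2,3)]
      ideal_prod_monomial_span monomial_span_eq_iff
      semigroup_from_reduction_iff[OF assms, symmetric] Suc_eq_plus1[symmetric]
    by simp
qed

section \<open>Cech cohomology\<close>

lemma cech_diff_add: "cech_diff I (\<lambda>F. c F + c' F) = (\<lambda>F. cech_diff I c F + cech_diff I c' F)"
  by (auto simp: cech_diff_def fun_eq_iff distrib_left sum.distrib)

lemma cech_diff_uminus: "cech_diff I (\<lambda>F. - c F) = (\<lambda>F. - cech_diff I c F)"
  by (auto simp: cech_diff_def fun_eq_iff sum_negf)

text \<open>The smaller of \<open>a\<close> and \<open>v\<close> is counted in the position of the
  larger one, so interchanging the deletion of \<open>a\<close> and the insertion of
  \<open>v\<close> changes exactly one sign.\<close>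

lemma cech_sign_swap:
  fixes a v :: "'i::linorder"
  assumes "finite F" "a \<in> F" "v \<notin> F"
  shows "(-1) ^ card {b\<in>F. b < a} * (-1) ^ card {b\<in>F - {a}. b < v}
    = - ((-1) ^ card {b\<in>F. b < v} * (-1) ^ card {b\<in>insert v F. b < a} :: 'a::comm_ring_1)"
proof (cases "a < v")
  case True
  then have "{b\<in>insert v F. b < a} = {b\<in>F. b < a}"
    "{b\<in>F. b < v} = insert a {b\<in>F - {a}. b < v}"
    using assms(2) by auto
  then show ?thesis using assms(1) by (simp add: mult.commute)
next
  case False
  with assms have "v < a" by (metis linorder_less_linear)
  then have "{b\<in>insert v F. b < a} = insert v {b\<in>F. b < a}"
    "{b\<in>F - {a}. b < v} = {b\<in>F. b < v}"
    by auto
  then show ?thesis using assms(1,3) by (simp add: mult.commute)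
qed

text \<open>The standard contraction of the cochain complex of a full simplex to the vertex
  \<open>v\<close>.\<close>

definition cone_homotopy :: "'i::linorder \<Rightarrow> ('i set \<Rightarrow> 'a::comm_ring_1) \<Rightarrow> 'i set \<Rightarrow> 'a" where
  "cone_homotopy v c F = (if v \<in> F then 0 else (-1) ^ card {b\<in>F. b < v} * c (insert v F))"

text \<open>If \<open>v\<close> lies in \<open>F\<close>, only the face omitting \<open>v\<close>
  contributes. Otherwise the cocycle condition on \<open>insert v F\<close> expresses
  \<open>c F\<close> by the faces containing \<open>v\<close>, and the signs match by
  \<open>cech_sign_swap\<close>.\<close>

lemma cech_diff_cone_homotopy:
  fixes c :: "'i::linorder set \<Rightarrow> 'a::comm_ring_1"
  assumes "finite I" "v \<in> I" "F \<subseteq> I" and cocycle: "cech_diff I c (insert v F) = 0"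
  shows "cech_diff I (cone_homotopy v c) F = c F"
proof -
  define \<sigma> :: "'i \<Rightarrow> 'i set \<Rightarrow> 'a" where "\<sigma> a F = (-1) ^ card {b\<in>F. b < a}" for a F
  have sq: "\<sigma> a F * \<sigma> a F = 1" for a F
    by (simp add: \<sigma>_def flip: power_add mult_2 power_mult)
  have fin: "finite F" using assms by (blast intro: finite_subset)
  have lhs: "cech_diff I (cone_homotopy v c) F = (\<Sum>a\<in>F. \<sigma> a F * cone_homotopy v c (F - {a}))"
    using assms(3) by (simp add: cech_diff_def \<sigma>_def)
  show ?thesis
  proof (cases "v \<in> F")
    case True
    have "(\<Sum>a\<in>F. \<sigma> a F * cone_homotopy v c (F - {a})) = \<sigma> v F * cone_homotopy v c (F - {v})"
      using fin True by (subst sum.remove[of _ v]) (auto simp: cone_homotopy_def intro!: sum.neutral split: if_splits)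
    also have "cone_homotopy v c (F - {v}) = \<sigma> v F * c F"
    proof -
      have "{b\<in>F - {v}. b < v} = {b\<in>F. b < v}" by auto
      then show ?thesis using True by (simp add: cone_homotopy_def \<sigma>_def insert_absorb)
    qed
    finally show ?thesis unfolding lhs by (simp add: sq flip: mult.assoc)
  next
    case False
    have "0 = cech_diff I c (insert v F)" using cocycle by simp
    also have "\<dots> = (\<Sum>a\<in>insert v F. \<sigma> a (insert v F) * c (insert v F - {a}))"
      using assms by (simp add: cech_diff_def \<sigma>_def)
    also have "\<dots> = \<sigma> v F * c F + (\<Sum>a\<in>F. \<sigma> a (insert v F) * c (insert v F - {a}))"
    proof -
      have "{b\<in>insert v F. b < v} = {b\<in>F. b < v}" by auto
      then show ?thesis using fin False by (simp add: \<sigma>_def)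
    qed
    finally have eq: "(\<Sum>a\<in>F. \<sigma> a (insert v F) * c (insert v F - {a})) = - (\<sigma> v F * c F)"
      by (simp add: eq_neg_iff_add_eq_0 add.commute)
    have "(\<Sum>a\<in>F. \<sigma> a F * cone_homotopy v c (F - {a}))
        = (\<Sum>a\<in>F. - (\<sigma> v F * (\<sigma> a (insert v F) * c (insert v F - {a}))))"
    proof (rule sum.cong[OF refl])
      fix a assume a: "a \<in> F"
      then have "insert v F - {a} = insert v (F - {a})" using False by auto
      moreover have "\<sigma> a F * \<sigma> v (F - {a}) = - (\<sigma> v F * \<sigma> a (insert v F))"
        unfolding \<sigma>_def using fin a False by (rule cech_sign_swap)
      moreover have "cone_homotopy v c (F - {a}) = \<sigma> v (F - {a}) * c (insert v (F - {a}))"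
        using False by (simp add: cone_homotopy_def \<sigma>_def)
      ultimately show "\<sigma> a F * cone_homotopy v c (F - {a})
          = - (\<sigma> v F * (\<sigma> a (insert v F) * c (insert v F - {a})))"
        by (simp flip: mult.assoc)
    qed
    also have "\<dots> = - (\<sigma> v F * - (\<sigma> v F * c F))"
      by (simp add: sum_negf eq flip: sum_distrib_left)
    also have "\<dots> = c F" by (simp add: sq flip: mult.assoc)
    finally show ?thesis unfolding lhs .
  qed
qed

lemma lookup_sign_mult:
  "Poly_Mapping.lookup ((-1) ^ n * f :: 'k::field laurent2) u = (-1) ^ n * Poly_Mapping.lookup f u"
  by (cases "even n") simp_all

text \<open>The differential acts on each coefficient separately, so the complex may be contracted
  exponent by exponent.\<close>

lemma lookup_cech_diff:
  "Poly_Mapping.lookup (cech_diff I c F :: 'k::field laurent2) u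
    = cech_diff I (\<lambda>F. Poly_Mapping.lookup (c F) u) F"
  by (simp add: cech_diff_def lookup_sum lookup_sign_mult)

text \<open>A coset of \<open>B\<close> through \<open>f\<close> equals \<open>B\<close> only if it
  contains \<open>f = 0 + f\<close>; conversely, translation by an element of \<open>B\<close>
  permutes \<open>B\<close>.\<close>

lemma trivial_group_Mod_iff:
  assumes mult: "\<And>f g. mult G f g = (\<lambda>x. f x + g x :: 'a::ab_group_add)"
    and carrier: "(\<lambda>x. 0) \<in> carrier G"
    and zero: "(\<lambda>x. 0) \<in> B" and add: "\<And>f g. f \<in> B \<Longrightarrow> g \<in> B \<Longrightarrow> (\<lambda>x. f x + g x) \<in> B"
    and uminus: "\<And>f. f \<in> B \<Longrightarrow> (\<lambda>x. - f x) \<in> B"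
  shows "trivial_group (G Mod B) \<longleftrightarrow> carrier G \<subseteq> B"
proof
  assume "trivial_group (G Mod B)"
  then have "rcosets\<^bsub>G\<^esub> B = {B}" by (simp add: trivial_group_def FactGroup_def)
  then have coset: "B #>\<^bsub>G\<^esub> f = B" if "f \<in> carrier G" for f
    using that by (auto simp: RCOSETS_def)
  show "carrier G \<subseteq> B"
  proof
    fix f assume "f \<in> carrier G"
    then show "f \<in> B" using coset[of f] zero by (force simp: r_coset_def mult)
  qed
next
  assume sub: "carrier G \<subseteq> B"
  have coset: "B #>\<^bsub>G\<^esub> f = B" if f: "f \<in> B" for f
  proof (intro equalityI subsetI)
    fix g assume g: "g \<in> B"
    have "(\<lambda>x. g x + - f x) \<in> B" by (intro add g uminus f)
    moreover have "g = (\<lambda>x. (\<lambda>x. g x + - f x) x + f x)" by simp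
    ultimately show "g \<in> B #>\<^bsub>G\<^esub> f" unfolding r_coset_def mult by blast
  qed (auto simp: r_coset_def mult intro: add f)
  have "rcosets\<^bsub>G\<^esub> B = {B}" using coset sub carrier by (auto simp: RCOSETS_def)
  moreover have "B <#>\<^bsub>G\<^esub> B = B"
  proof -
    have "B <#>\<^bsub>G\<^esub> B = (\<Union>f\<in>B. B #>\<^bsub>G\<^esub> f)" by (auto simp: set_mult_def r_coset_def)
    then show ?thesis using coset zero by auto
  qed
  ultimately show "trivial_group (G Mod B)"
    unfolding trivial_group_def by (auto simp: FactGroup_def intro!: groupI)
qed

section \<open>Localizations of the semigroup ring\<close>

definition pt_scale :: "nat \<Rightarrow> int \<times> int \<Rightarrow> int \<times> int" where
  "pt_scale n w = (int n * fst w, int n * snd w)"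

lemma t_monom_mult: "t_monom u * t_monom v = (t_monom (u + v) :: 'k::field laurent2)"
  by (simp add: t_monom_def mult_single)

lemma t_monom_zero: "t_monom 0 = (1 :: 'k::field laurent2)"
  by (simp add: t_monom_def)

lemma t_monom_prod: "(\<Prod>a\<in>F. t_monom (e a)) = (t_monom (\<Sum>a\<in>F. e a) :: 'k::field laurent2)"
  by (induction F rule: infinite_finite_induct) (simp_all add: t_monom_mult t_monom_zero)

lemma t_monom_power: "t_monom w ^ n = (t_monom (pt_scale n w) :: 'k::field laurent2)"
proof (induction n)
  case (Suc n)
  have "w + pt_scale n w = pt_scale (Suc n) w"
    by (simp add: pt_scale_def prod_eq_iff algebra_simps)
  with Suc show ?case by (simp add: t_monom_mult)
qed (simp add: pt_scale_def t_monom_zero flip: zero_prod_def)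

text \<open>Multiplying back by the inverse monomial \<open>t_monom (- w)\<close> shows that no key
  is lost.\<close>

lemma keys_t_monom_mult:
  "Poly_Mapping.keys (t_monom w * g :: 'k::field laurent2) = (+) w ` Poly_Mapping.keys g"
proof (intro equalityI subsetI)
  fix u assume "u \<in> Poly_Mapping.keys (t_monom w * g)"
  then show "u \<in> (+) w ` Poly_Mapping.keys g" using keys_mult[of "t_monom w" g] unfolding keys_t_monom by blast
next
  fix u assume "u \<in> (+) w ` Poly_Mapping.keys g"
  then obtain v where v: "u = w + v" "v \<in> Poly_Mapping.keys g" by blast
  have eq: "t_monom (- w) * (t_monom w * g) = g"
    by (simp add: t_monom_mult t_monom_zero flip: mult.assoc)
  have "v \<in> Poly_Mapping.keys (t_monom (- w) * (t_monom w * g))" unfolding eq by (rule v(2))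
  with keys_mult[of "t_monom (- w)" "t_monom w * g"]
  obtain k where "v = - w + k" "k \<in> Poly_Mapping.keys (t_monom w * g)"
    unfolding keys_t_monom by blast
  with v(1) show "u \<in> Poly_Mapping.keys (t_monom w * g)" by simp
qed

lemma pt_scale_in_closed:
  assumes "0 \<in> S" "S + S \<subseteq> S" "w \<in> S"
  shows "pt_scale n w \<in> S"
proof (induction n)
  case (Suc n)
  have "pt_scale (Suc n) w = w + pt_scale n w"
    by (simp add: pt_scale_def prod_eq_iff algebra_simps)
  with Suc assms show ?case by auto
qed (use assms in \<open>simp add: pt_scale_def flip: zero_prod_def\<close>)

text \<open>A Laurent polynomial has finitely many keys, so one power of the monomial clears all of
  them; enlarging the power is harmless because \<open>S\<close> is closed under adding
  \<open>w\<close>.\<close>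

lemma localization_t_monom:
  assumes S: "0 \<in> S" "S + S \<subseteq> S" and w: "w \<in> S"
  shows "localization (monomial_span S) (t_monom w)
    = (monomial_span {u. \<exists>n. pt_scale n w + u \<in> S} :: 'k::field laurent2 set)"
proof (intro equalityI subsetI)
  fix g :: "'k laurent2" assume g: "g \<in> monomial_span {u. \<exists>n. pt_scale n w + u \<in> S}"
  then have "\<forall>u\<in>Poly_Mapping.keys g. \<exists>n. pt_scale n w + u \<in> S"
    unfolding monomial_span_def by blast
  from bchoice[OF this] obtain n where n: "\<And>u. u \<in> Poly_Mapping.keys g \<Longrightarrow> pt_scale (n u) w + u \<in> S"
    by blast
  \<comment> \<open>The sum serves as a common upper bound for the exponents
    \<open>n u\<close>.\<close>
  define m where "m = (\<Sum>u\<in>Poly_Mapping.keys g. n u)"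
  have "pt_scale m w + u \<in> S" if "u \<in> Poly_Mapping.keys g" for u
  proof -
    have "n u \<le> m" unfolding m_def using that by (intro member_le_sum) auto
    then have "pt_scale m w + u = pt_scale (m - n u) w + (pt_scale (n u) w + u)"
      by (simp add: pt_scale_def prod_eq_iff of_nat_diff algebra_simps)
    also have "\<dots> \<in> S"
      using S(2) pt_scale_in_closed[OF S w] n[OF that] by (blast intro: set_plus_intro)
    finally show ?thesis .
  qed
  then have "t_monom w ^ m * g \<in> monomial_span S"
    by (auto simp: monomial_span_def t_monom_power keys_t_monom_mult)
  then show "g \<in> localization (monomial_span S) (t_monom w)"
    unfolding localization_def by blast
qed (auto simp: localization_def monomial_span_def t_monom_power keys_t_monom_mult)

text \<open>For \<open>F \<subseteq> A\<close>, the exponents of the degree \<open>d\<close> part of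
  the localization at the product of the generators indexed by \<open>F\<close>.\<close>

definition loc_pts :: "nat \<Rightarrow> nat set \<Rightarrow> int \<Rightarrow> nat set \<Rightarrow> (int \<times> int) set" where
  "loc_pts \<alpha> A d F = {u. fst u + snd u = int \<alpha> * d
     \<and> (\<exists>n. pt_scale n (\<Sum>a\<in>F. gen \<alpha> a) + u \<in> proj_semigroup \<alpha> A)}"

lemma localization_semigroup_ring:
  assumes "F \<subseteq> A"
  shows "localization (carrier (semigroup_ring (proj_semigroup \<alpha> A))) (\<Prod>a\<in>F. t_monom (gen \<alpha> a))
      \<inter> homog_part \<alpha> d = (monomial_span (loc_pts \<alpha> A d F) :: 'k::field laurent2 set)"
proof -
  have S: "0 \<in> proj_semigroup \<alpha> A" "proj_semigroup \<alpha> A + proj_semigroup \<alpha> A \<subseteq> proj_semigroup \<alpha> A"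
    using semigroup_from_closed[of \<alpha> A] by (simp_all add: proj_semigroup_eq)
  have "(\<Sum>a\<in>F. gen \<alpha> a) \<in> proj_semigroup \<alpha> A"
    using assms
    by (induction F rule: infinite_finite_induct) (auto intro: proj_semigroup.intros S(1))
  then show ?thesis
    unfolding carrier_semigroup_ring t_monom_prod
    by (simp add: localization_t_monom[OF S])
      (auto simp: monomial_span_def homog_part_def loc_pts_def)
qed

lemma cech_cochains_semigroup_ring:
  "cech_cochains (carrier (semigroup_ring (proj_semigroup \<alpha> A)) :: 'k::field laurent2 set)
      (\<lambda>a. t_monom (gen \<alpha> a)) A (homog_part \<alpha> d) p
    = {c. \<forall>F. if F \<subseteq> A \<and> card F = p then c F \<in> monomial_span (loc_pts \<alpha> A d F) else c F = 0}"
  unfolding cech_cochains_def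
  using localization_semigroup_ring[of _ A \<alpha> d, where 'k = 'k]
  by (intro Collect_cong all_cong1) (simp split: if_split)

lemma local_cohomology_trivial_iff:
  fixes \<alpha> :: nat and A :: "nat set" and d :: int
  defines "R \<equiv> carrier (semigroup_ring (proj_semigroup \<alpha> A)) :: 'k::field laurent2 set"
    and "x \<equiv> (\<lambda>a. t_monom (gen \<alpha> a))" and "H \<equiv> homog_part \<alpha> d"
  shows "trivial_group (local_cohomology TYPE('k) \<alpha> A p d)
    \<longleftrightarrow> cech_cocycles R x A H p \<subseteq> cech_coboundaries R x A H p"
proof -
  have cochains: "cech_cochains R x A H q
      = {c. \<forall>F. if F \<subseteq> A \<and> card F = q then c F \<in> monomial_span (loc_pts \<alpha> A d F) else c F = 0}" for q
    unfolding R_def x_def H_def by (rule cech_cochains_semigroup_ring)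
  have zero: "(\<lambda>F. 0) \<in> cech_cochains R x A H q" for q
    unfolding cochains by (simp add: monomial_span_def)
  have add: "(\<lambda>F. c F + c' F) \<in> cech_cochains R x A H q"
    if "c \<in> cech_cochains R x A H q" "c' \<in> cech_cochains R x A H q" for c c' q
    using that unfolding cochains by (simp add: monomial_span_add)
  have uminus: "(\<lambda>F. - c F) \<in> cech_cochains R x A H q"
    if "c \<in> cech_cochains R x A H q" for c q
    using that unfolding cochains by (simp add: monomial_span_uminus)
  show ?thesis
    unfolding local_cohomology_def cech_cohomology_def R_def[symmetric] x_def[symmetric]
      H_def[symmetric]
  proof (subst trivial_group_Mod_iff)
    show "(\<lambda>F. 0) \<in> cech_coboundaries R x A H p"
      using zero by (cases p) (auto simp: cech_coboundaries_def cech_diff_def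
          intro!: image_eqI[of _ _ "\<lambda>F. 0"])
    fix c assume c: "c \<in> cech_coboundaries R x A H p"
    show "(\<lambda>F. - c F) \<in> cech_coboundaries R x A H p"
      using c uminus by (cases p) (auto simp: cech_coboundaries_def simp flip: cech_diff_uminus)
    fix c' assume c': "c' \<in> cech_coboundaries R x A H p"
    show "(\<lambda>F. c F + c' F) \<in> cech_coboundaries R x A H p"
      using c c' add by (cases p) (auto simp: cech_coboundaries_def simp flip: cech_diff_add)
  qed (auto simp: cech_cocycles_def cech_diff_def zero)
qed

section \<open>Smooth monomial curves\<close>

locale monomial_curve =
  fixes \<alpha> :: nat and A :: "nat set"
  assumes subset: "A \<subseteq> {..\<alpha>}" and ends: "{0, 1, \<alpha> - 1, \<alpha>} \<subseteq> A" and alpha_pos: "0 < \<alpha>"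
begin

lemma finite_A: "finite A"
  using subset by (rule finite_subset) simp

text \<open>The reverse inclusion follows from \<open>A \<subseteq> {..\<alpha>}\<close>, so this
  says that degree \<open>n\<close> has no holes.\<close>

definition full :: "nat \<Rightarrow> bool" where
  "full n \<longleftrightarrow> {..n * \<alpha>} \<subseteq> sumset A n"

lemma full_mono: "full m \<Longrightarrow> 1 \<le> m \<Longrightarrow> m \<le> n \<Longrightarrow> full n"
  unfolding full_def using sumset_full_mono[of m \<alpha> A n] ends by simp

text \<open>Bridging the gaps with \<open>e = 1\<close> and the crude gap bound
  \<open>g = \<alpha>\<close>, for which \<open>k = \<alpha>\<close> summands suffice. Hence every
  sufficiently large degree is full.\<close>

lemma full_Suc_alpha: "full (Suc \<alpha>)"
  unfolding full_def
proof (rule sumset_full_if_gaps_le)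
  show "{0..1} \<subseteq> A" using ends by (auto simp: le_Suc_eq)
  show "\<alpha> - i \<in> A" if "i \<le> 1" for i using that ends by (auto simp: le_Suc_eq)
  show "\<exists>a\<in>A. a \<le> y \<and> y \<le> a + \<alpha>" if "y \<le> \<alpha>" for y
    using that ends by (intro bexI[of _ 0]) auto
qed (use alpha_pos in auto)

section \<open>Localizations described by sign conditions\<close>

lemma degree_iff_pt:
  "(0 \<le> fst u \<and> 0 \<le> snd u \<and> fst u + snd u = int \<alpha> * int n) \<longleftrightarrow> (\<exists>s\<le>n * \<alpha>. u = pt \<alpha> n s)"
proof
  assume u: "0 \<le> fst u \<and> 0 \<le> snd u \<and> fst u + snd u = int \<alpha> * int n"
  then have "int (nat (fst u)) \<le> int (n * \<alpha>)" by (simp add: mult.commute)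
  with u show "\<exists>s\<le>n * \<alpha>. u = pt \<alpha> n s"
    by (intro exI[of _ "nat (fst u)"] conjI) (simp only: of_nat_le_iff, simp add: pt_def prod_eq_iff algebra_simps)
next
  assume "\<exists>s\<le>n * \<alpha>. u = pt \<alpha> n s"
  then obtain s where s: "s \<le> n * \<alpha>" "u = pt \<alpha> n s" by blast
  then have "int s \<le> int n * int \<alpha>" by (metis of_nat_le_iff of_nat_mult)
  with s show "0 \<le> fst u \<and> 0 \<le> snd u \<and> fst u + snd u = int \<alpha> * int n"
    by (simp add: pt_def algebra_simps)
qed

lemma proj_semigroup_nonneg:
  assumes "u \<in> proj_semigroup \<alpha> A"
  shows "0 \<le> fst u" "0 \<le> snd u"
proof -
  from assms obtain n s where "u = pt \<alpha> n s" "s \<in> sumset A n"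
    by (auto simp: proj_semigroup_eq semigroup_from_def)
  moreover from this(2) have "s \<le> n * \<alpha>" using subset by (intro sumset_le)
  ultimately show "0 \<le> fst u" "0 \<le> snd u" using degree_iff_pt[of u n] by blast+
qed

lemma full_in_semigroup:
  assumes "full n" "0 \<le> fst u" "0 \<le> snd u" "fst u + snd u = int \<alpha> * int n"
  shows "u \<in> proj_semigroup \<alpha> A"
  using assms degree_iff_pt[of u n]
  by (auto simp: proj_semigroup_eq full_def intro!: pt_in_semigroup_from)

lemma loc_pts_empty: "loc_pts \<alpha> A d {} = {u \<in> proj_semigroup \<alpha> A. fst u + snd u = int \<alpha> * d}"
  by (auto simp: loc_pts_def pt_scale_def simp flip: zero_prod_def)

lemma loc_pts_degree: "u \<in> loc_pts \<alpha> A d F \<Longrightarrow> fst u + snd u = int \<alpha> * d"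
  by (simp add: loc_pts_def)

text \<open>If no index in \<open>F\<close> is positive, multiples of the sum of the generators
  leave the first coordinate unchanged; if none is below \<open>\<alpha>\<close>, they leave the
  second unchanged.\<close>

lemma loc_pts_signs:
  assumes "F \<subseteq> A" "u \<in> loc_pts \<alpha> A d F"
  shows "0 \<le> fst u \<or> (\<exists>a\<in>F. 0 < a)" "0 \<le> snd u \<or> (\<exists>a\<in>F. a < \<alpha>)"
proof -
  from assms(2) obtain n where n: "pt_scale n (\<Sum>a\<in>F. gen \<alpha> a) + u \<in> proj_semigroup \<alpha> A"
    by (auto simp: loc_pts_def)
  note * = proj_semigroup_nonneg[OF n]
  show "0 \<le> fst u \<or> (\<exists>a\<in>F. 0 < a)"
  proof (rule disjCI)
    assume "\<not> (\<exists>a\<in>F. 0 < a)"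
    then have "(\<Sum>a\<in>F. fst (gen \<alpha> a)) = 0" by (intro sum.neutral) (auto simp: gen_def)
    with *(1) show "0 \<le> fst u" by (simp add: pt_scale_def fst_sum)
  qed
  show "0 \<le> snd u \<or> (\<exists>a\<in>F. a < \<alpha>)"
  proof (rule disjCI)
    assume "\<not> (\<exists>a\<in>F. a < \<alpha>)"
    then have "a = \<alpha>" if "a \<in> F" for a using that assms(1) subset by fastforce
    then have "(\<Sum>a\<in>F. snd (gen \<alpha> a)) = 0" by (intro sum.neutral) (auto simp: gen_def)
    with *(2) show "0 \<le> snd u" by (simp add: pt_scale_def snd_sum)
  qed
qed

text \<open>A large multiple of the sum of the generators moves the point into the nonnegative quadrant
  and into a degree in which the semigroup has no holes.\<close>

lemma loc_ptsI:
  assumes F: "F \<subseteq> A" "F \<noteq> {}" and deg: "fst u + snd u = int \<alpha> * d"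
    and x: "0 \<le> fst u \<or> (\<exists>a\<in>F. 0 < a)" and y: "0 \<le> snd u \<or> (\<exists>a\<in>F. a < \<alpha>)"
  shows "u \<in> loc_pts \<alpha> A d F"
proof -
  define X where "X = (\<Sum>a\<in>F. int a)"
  define Y where "Y = (\<Sum>a\<in>F. int \<alpha> - int a)"
  have fin: "finite F" using F(1) finite_A by (rule finite_subset)
  have le: "a \<le> \<alpha>" if "a \<in> F" for a using that F(1) subset by auto
  have sum: "(\<Sum>a\<in>F. gen \<alpha> a) = (X, Y)" by (simp add: gen_def X_def Y_def sum_prod)
  have XY: "X + Y = int \<alpha> * int (card F)"
    by (simp add: X_def Y_def mult.commute flip: sum.distrib)
  have X0: "0 \<le> X" and Y0: "0 \<le> Y" using le by (auto simp: X_def Y_def intro!: sum_nonneg)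
  have X1: "1 \<le> X" if "a \<in> F" "0 < a" for a
    using member_le_sum[of a F int] fin that by (simp add: X_def)
  have Y1: "1 \<le> Y" if "a \<in> F" "a < \<alpha>" for a
    using member_le_sum[of a F "\<lambda>a. int \<alpha> - int a"] fin that le by (force simp: Y_def)
  \<comment> \<open>Large enough to outweigh both coordinates and to bring the degree
    \<open>n * card F + d\<close> to at least \<open>\<alpha> + 1\<close>, where all degrees are
    full.\<close>
  define n where "n = nat (int \<alpha> + 1 + \<bar>d\<bar> + \<bar>fst u\<bar> + \<bar>snd u\<bar>)"
  have n: "int n = int \<alpha> + 1 + \<bar>d\<bar> + \<bar>fst u\<bar> + \<bar>snd u\<bar>" by (simp add: n_def)
  have xn: "0 \<le> int n * X + fst u"
  proof (cases "0 \<le> fst u")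
    case False
    with x X1 have "int n * 1 \<le> int n * X" by (intro mult_left_mono) auto
    with n show ?thesis by linarith
  qed (use X0 in simp)
  have yn: "0 \<le> int n * Y + snd u"
  proof (cases "0 \<le> snd u")
    case False
    with y Y1 have "int n * 1 \<le> int n * Y" by (intro mult_left_mono) auto
    with n show ?thesis by linarith
  qed (use Y0 in simp)
  have "1 \<le> card F" using F(2) fin by (simp add: Suc_le_eq card_gt_0_iff)
  then have "int n * 1 \<le> int n * int (card F)" by (intro mult_left_mono) auto
  then have "int (Suc \<alpha>) \<le> int n * int (card F) + d" using n by linarith
  then obtain m where m: "int n * int (card F) + d = int m" "Suc \<alpha> \<le> m"
    by (metis nat_0_le of_nat_0_le_iff of_nat_le_iff order_trans)
  have "pt_scale n (X, Y) + u \<in> proj_semigroup \<alpha> A"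
  proof (rule full_in_semigroup)
    show "full m" using full_Suc_alpha m(2) by (intro full_mono[of "Suc \<alpha>" m]) simp_all
    have "(int n * X + fst u) + (int n * Y + snd u) = int n * (X + Y) + (fst u + snd u)"
      by (simp add: algebra_simps)
    also have "\<dots> = int \<alpha> * int m" by (simp add: XY deg algebra_simps flip: m(1))
    finally show "fst (pt_scale n (X, Y) + u) + snd (pt_scale n (X, Y) + u) = int \<alpha> * int m"
      by (simp add: pt_scale_def)
  qed (use xn yn in \<open>simp_all add: pt_scale_def\<close>)
  with deg show ?thesis by (auto simp: loc_pts_def sum)
qed

section \<open>Vanishing and nonvanishing of local cohomology in a given degree\<close>

text \<open>Inverting \<open>gen \<alpha> \<alpha>\<close> frees only the first coordinate,
  inverting \<open>gen \<alpha> 0\<close> only the second. So the vertex never relaxes the condition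
  on a negative second coordinate, and for a nonnegative one it leaves the condition on the first
  unchanged.\<close>

definition cone_vertex :: "int \<times> int \<Rightarrow> nat" where
  "cone_vertex u = (if snd u < 0 then \<alpha> else 0)"

abbreviation cochains :: "int \<Rightarrow> nat \<Rightarrow> (nat set \<Rightarrow> 'k::field laurent2) set" where
  "cochains d p \<equiv> cech_cochains (carrier (semigroup_ring (proj_semigroup \<alpha> A)))
     (\<lambda>a. t_monom (gen \<alpha> a)) A (homog_part \<alpha> d) p"

abbreviation cocycles :: "int \<Rightarrow> nat \<Rightarrow> (nat set \<Rightarrow> 'k::field laurent2) set" where
  "cocycles d p \<equiv> cech_cocycles (carrier (semigroup_ring (proj_semigroup \<alpha> A)))
     (\<lambda>a. t_monom (gen \<alpha> a)) A (homog_part \<alpha> d) p"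

abbreviation coboundaries :: "int \<Rightarrow> nat \<Rightarrow> (nat set \<Rightarrow> 'k::field laurent2) set" where
  "coboundaries d p \<equiv> cech_coboundaries (carrier (semigroup_ring (proj_semigroup \<alpha> A)))
     (\<lambda>a. t_monom (gen \<alpha> a)) A (homog_part \<alpha> d) p"

text \<open>The Cech complex splits over the exponents \<open>u\<close>, and each summand is contracted by coning from
  the vertex \<open>cone_vertex u\<close>.\<close>

lemma cocycles_subset_coboundaries:
  assumes closed: "\<And>F u. F \<subseteq> A \<Longrightarrow> card F = q \<Longrightarrow> cone_vertex u \<notin> F
      \<Longrightarrow> u \<in> loc_pts \<alpha> A d (insert (cone_vertex u) F) \<Longrightarrow> u \<in> loc_pts \<alpha> A d F"
  shows "cocycles d (Suc q) \<subseteq> (coboundaries d (Suc q) :: (nat set \<Rightarrow> 'k::field laurent2) set)"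
proof
  fix c :: "nat set \<Rightarrow> 'k laurent2" assume "c \<in> cocycles d (Suc q)"
  then have all: "\<forall>F. if F \<subseteq> A \<and> card F = Suc q then c F \<in> monomial_span (loc_pts \<alpha> A d F)
      else c F = 0"
    and dc: "cech_diff A c = (\<lambda>F. 0)"
    by (simp_all add: cech_cocycles_def cech_cochains_semigroup_ring)
  have c: "F \<subseteq> A \<Longrightarrow> card F = Suc q \<Longrightarrow> Poly_Mapping.keys (c F) \<subseteq> loc_pts \<alpha> A d F"
    "\<not> (F \<subseteq> A \<and> card F = Suc q) \<Longrightarrow> c F = 0" for F
    using spec[OF all, of F] by (simp_all add: monomial_span_def split: if_splits)
  have cone: "cone_vertex u \<in> A" for u using ends by (auto simp: cone_vertex_def)
  \<comment> \<open>The homotopy is applied to each coefficient, because its vertex depends on the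
    exponent.\<close>
  define b' where "b' F u = cone_homotopy (cone_vertex u) (\<lambda>F. Poly_Mapping.lookup (c F) u) F" for F u
  have b'_nz: "cone_vertex u \<notin> F \<and> F \<subseteq> A \<and> card F = q
      \<and> u \<in> Poly_Mapping.keys (c (insert (cone_vertex u) F))" if "b' F u \<noteq> 0" for F u
  proof -
    from that have nz: "cone_vertex u \<notin> F" "Poly_Mapping.lookup (c (insert (cone_vertex u) F)) u \<noteq> 0"
      by (auto simp: b'_def cone_homotopy_def split: if_splits)
    have F: "insert (cone_vertex u) F \<subseteq> A \<and> card (insert (cone_vertex u) F) = Suc q"
    proof (rule ccontr)
      assume "\<not> ?thesis"
      from c(2)[OF this] nz(2) show False by simp
    qed
    then have "finite F" using finite_A by (auto intro: finite_subset)
    with nz F show ?thesis by (simp add: in_keys_iff)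
  qed
  \<comment> \<open>Only finitely many vertices occur, so the coefficients \<open>b' F\<close> have
    finite support and define a Laurent polynomial.\<close>
  have fin: "finite {u. b' F u \<noteq> 0}" for F
  proof (rule finite_subset)
    show "{u. b' F u \<noteq> 0} \<subseteq> (\<Union>a\<in>A. Poly_Mapping.keys (c (insert a F)))"
      using b'_nz cone by blast
  qed (use finite_A in auto)
  define b where "b F = Abs_poly_mapping (b' F)" for F
  have lookup_b: "Poly_Mapping.lookup (b F) = b' F" for F using fin by (simp add: b_def)
  have "b \<in> cochains d q"
    unfolding cech_cochains_semigroup_ring mem_Collect_eq
  proof (intro allI)
    fix F
    show "if F \<subseteq> A \<and> card F = q then b F \<in> monomial_span (loc_pts \<alpha> A d F) else b F = 0"
    proof (cases "F \<subseteq> A \<and> card F = q")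
      case True
      have "u \<in> loc_pts \<alpha> A d F" if "u \<in> Poly_Mapping.keys (b F)" for u
      proof -
        have u: "cone_vertex u \<notin> F" "u \<in> Poly_Mapping.keys (c (insert (cone_vertex u) F))"
          using b'_nz[of F u] that by (auto simp: in_keys_iff lookup_b)
        have "finite F" using True finite_A by (auto intro: finite_subset)
        then have "u \<in> loc_pts \<alpha> A d (insert (cone_vertex u) F)"
          using c(1)[of "insert (cone_vertex u) F"] u True cone by auto
        with True u(1) show ?thesis using closed[of F u] by blast
      qed
      with True show ?thesis by (auto simp: monomial_span_def)
    next
      case False
      then have "b' F u = 0" for u using b'_nz by blast
      then have "b F = 0" by (intro poly_mapping_eqI) (simp add: lookup_b)
      then show ?thesis by (simp add: monomial_span_def)
    qed
  qed
  moreover have "c = cech_diff A b"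
  proof
    fix F
    show "c F = cech_diff A b F"
    proof (cases "F \<subseteq> A")
      case True
      show ?thesis
      proof (rule poly_mapping_eqI)
        fix u
        let ?c = "\<lambda>F. Poly_Mapping.lookup (c F) u"
        have "Poly_Mapping.lookup (cech_diff A b F) u
            = cech_diff A (cone_homotopy (cone_vertex u) ?c) F"
          by (simp add: lookup_cech_diff lookup_b b'_def)
        also have "\<dots> = ?c F"
          using finite_A cone True
        proof (rule cech_diff_cone_homotopy)
          show "cech_diff A ?c (insert (cone_vertex u) F) = 0"
            by (simp add: dc flip: lookup_cech_diff)
        qed
        finally show "?c F = Poly_Mapping.lookup (cech_diff A b F) u" by simp
      qed
    next
      case False
      then show ?thesis using c(2) by (simp add: cech_diff_def)
    qed
  qed
  ultimately show "c \<in> coboundaries d (Suc q)" by (auto simp: cech_coboundaries_def)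
qed

text \<open>Localization maps are inclusions, so one vertex already recovers a cochain of degree
  \<open>0\<close>.\<close>

lemma cech_diff_vertex:
  fixes c :: "nat set \<Rightarrow> 'k::field laurent2"
  shows "cech_diff A c {0} = c {}"
  using ends by (simp add: cech_diff_def)

text \<open>For \<open>p = 0\<close> the differential is injective. For \<open>p > 0\<close> it must
  be checked that removing the cone vertex from the index set keeps the exponent in the
  localization: fullness ensures this for \<open>p = 1\<close>, the degree for \<open>p = 2\<close>,
  and the size of \<open>F\<close> for larger \<open>p\<close>.\<close>

lemma local_cohomology_trivial:
  assumes H1: "p = 1 \<Longrightarrow> 1 \<le> d \<and> full (nat d)" and H2: "p = 2 \<Longrightarrow> 0 \<le> d"
  shows "trivial_group (local_cohomology TYPE('k::field) \<alpha> A p d)"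
  unfolding local_cohomology_trivial_iff
proof (cases p)
  case 0
  show "cocycles d p \<subseteq> (coboundaries d p :: (nat set \<Rightarrow> 'k laurent2) set)"
  proof
    fix c :: "nat set \<Rightarrow> 'k laurent2" assume "c \<in> cocycles d p"
    then have all: "\<forall>F. if F \<subseteq> A \<and> card F = 0 then c F \<in> monomial_span (loc_pts \<alpha> A d F)
        else c F = 0"
      and dc: "cech_diff A c = (\<lambda>F. 0)"
      by (simp_all add: cech_cocycles_def cech_cochains_semigroup_ring 0)
    have c: "\<not> (F \<subseteq> A \<and> card F = 0) \<Longrightarrow> c F = 0" for F
      using spec[OF all, of F] by (simp split: if_splits)
    have "c {} = 0" using dc by (simp flip: cech_diff_vertex)
    moreover have "F = {}" if "F \<subseteq> A" "card F = 0" for F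
      using that finite_A by (auto dest: finite_subset)
    ultimately have "c F = 0" for F using c[of F] by (cases "F \<subseteq> A \<and> card F = 0") auto
    then have "c = (\<lambda>F. 0)" by blast
    then show "c \<in> coboundaries d p" by (simp add: cech_coboundaries_def 0)
  qed
next
  case (Suc q)
  show "cocycles d p \<subseteq> (coboundaries d p :: (nat set \<Rightarrow> 'k laurent2) set)"
    unfolding Suc
  proof (rule cocycles_subset_coboundaries)
    fix F u
    assume F: "F \<subseteq> A" "card F = q" and notin: "cone_vertex u \<notin> F"
      and u: "u \<in> loc_pts \<alpha> A d (insert (cone_vertex u) F)"
    have fin: "finite F" using F(1) finite_A by (rule finite_subset)
    have deg: "fst u + snd u = int \<alpha> * d" using u by (rule loc_pts_degree)
    have "insert (cone_vertex u) F \<subseteq> A" using F(1) ends by (auto simp: cone_vertex_def)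
    note signs = loc_pts_signs[OF this u]
    have y: "0 \<le> snd u \<or> (\<exists>a\<in>F. a < \<alpha>)"
      using signs(2) by (auto simp: cone_vertex_def split: if_splits)
    show "u \<in> loc_pts \<alpha> A d F"
    proof (cases "q = 0")
      case True
      then have "F = {}" using F fin by simp
      with y have "0 \<le> snd u" by simp
      moreover from this \<open>F = {}\<close> signs(1) have "0 \<le> fst u" by (auto simp: cone_vertex_def)
      ultimately have "u \<in> proj_semigroup \<alpha> A"
        using H1 deg Suc True by (intro full_in_semigroup[of "nat d"]) auto
      with \<open>F = {}\<close> deg show ?thesis by (simp add: loc_pts_empty)
    next
      case False
      have x: "0 \<le> fst u \<or> (\<exists>a\<in>F. 0 < a)"
      proof (cases "snd u < 0")
        case True
        consider "q = 1" | "2 \<le> q" using False by linarith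
        then show ?thesis
        proof cases
          case 1
          \<comment> \<open>In nonnegative degree a negative second coordinate forces the first to
            be nonnegative.\<close>
          then have "0 \<le> int \<alpha> * d" using H2 Suc by simp
          with deg True show ?thesis by simp
        next
          case 2
          \<comment> \<open>At least two indices cannot all be \<open>0\<close>, so a positive one
            remains to free the first coordinate.\<close>
          have "\<not> F \<subseteq> {0}"
          proof
            assume "F \<subseteq> {0}"
            from card_mono[OF _ this] have "card F \<le> 1" by simp
            with 2 F(2) show False by simp
          qed
          then show ?thesis by auto
        qed
      qed (use signs(1) in \<open>auto simp: cone_vertex_def\<close>)
      have "F \<noteq> {}" using False F by auto
      from loc_ptsI[OF F(1) this deg x y] show ?thesis .
    qed
  qed
qed

text \<open>The monomial of a hole has nonnegative exponents and lies in the localization at every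
  single generator. The constant family it defines is a cocycle, and it could only be a coboundary
  if the monomial lay in the ring itself.\<close>

lemma local_cohomology_nontrivial:
  assumes "\<not> full n"
  shows "\<not> trivial_group (local_cohomology TYPE('k::field) \<alpha> A 1 (int n))"
proof -
  from assms obtain s where s: "s \<le> n * \<alpha>" "s \<notin> sumset A n" by (auto simp: full_def)
  define u where "u = pt \<alpha> n s"
  have u: "0 \<le> fst u" "0 \<le> snd u" "fst u + snd u = int \<alpha> * int n"
    using degree_iff_pt[of u n] s(1) by (auto simp: u_def)
  have notin: "u \<notin> proj_semigroup \<alpha> A"
    using s(2) alpha_pos by (simp add: u_def proj_semigroup_eq pt_in_semigroup_from_iff)
  define c :: "nat set \<Rightarrow> 'k laurent2"
    where "c F = (if F \<subseteq> A \<and> card F = 1 then t_monom u else 0)" for F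
  have "c \<in> cochains (int n) 1"
    unfolding cech_cochains_semigroup_ring mem_Collect_eq
  proof (intro allI)
    fix F
    have "u \<in> loc_pts \<alpha> A (int n) F" if "F \<subseteq> A" "card F = 1"
      using that u by (intro loc_ptsI) auto
    then show "if F \<subseteq> A \<and> card F = 1 then c F \<in> monomial_span (loc_pts \<alpha> A (int n) F) else c F = 0"
      by (simp add: c_def t_monom_in_span_iff)
  qed
  moreover have "cech_diff A c F = 0" for F
  proof (cases "F \<subseteq> A \<and> card F = 2")
    case True
    then obtain a b where ab: "F = {a, b}" "a < b"
      by (metis card_2_iff insert_commute linorder_neqE_nat)
    then have sets: "{x \<in> F. x < a} = {}" "{x \<in> F. x < b} = {a}" "F - {a} = {b}" "F - {b} = {a}"
      by auto
    have sum: "sum f F = f a + f b" for f :: "nat \<Rightarrow> 'k laurent2" using ab by simp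
    have cards: "card {x \<in> F. x < a} = 0" "card {x \<in> F. x < b} = 1"
      unfolding sets by simp_all
    have "cech_diff A c F = (\<Sum>x\<in>F. (-1) ^ card {y\<in>F. y < x} * c (F - {x}))"
      using True by (simp only: cech_diff_def if_True)
    also have "\<dots> = c {b} - c {a}"
      unfolding sum cards sets(3,4) by simp
    finally show ?thesis using True unfolding c_def ab(1) by simp
  next
    case False
    have "c (F - {a}) = 0" if "a \<in> F" "F \<subseteq> A" for a
    proof -
      have "finite F" using that finite_A by (auto intro: finite_subset)
      then have "card F = Suc (card (F - {a}))" by (rule card.remove) (rule that(1))
      with False that(2) have "card (F - {a}) \<noteq> 1" by auto
      then show ?thesis by (simp add: c_def)
    qed
    then show ?thesis by (auto simp: cech_diff_def)
  qed
  ultimately have "c \<in> cocycles (int n) 1" by (simp add: cech_cocycles_def fun_eq_iff)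
  moreover have "c \<notin> coboundaries (int n) 1"
  proof
    assume "c \<in> coboundaries (int n) 1"
    then obtain b where b: "b \<in> cochains (int n) 0" "c = cech_diff A b"
      by (auto simp: cech_coboundaries_def)
    have "c {0} = b {}" by (simp add: b(2) cech_diff_vertex)
    moreover have "c {0} = t_monom u" using ends by (simp add: c_def)
    moreover have "b {} \<in> monomial_span (loc_pts \<alpha> A (int n) {})"
      using b(1) unfolding cech_cochains_semigroup_ring mem_Collect_eq
      by (metis card.empty empty_subsetI)
    ultimately have "(t_monom u :: 'k laurent2) \<in> monomial_span (loc_pts \<alpha> A (int n) {})" by metis
    with notin show False by (simp add: t_monom_in_span_iff loc_pts_empty)
  qed
  ultimately show ?thesis unfolding local_cohomology_trivial_iff by blast
qed

section \<open>Regularity as the least full degree\<close>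

text \<open>The bound \<open>1 \<le> n\<close> excludes degree \<open>0\<close>, which is always
  full.\<close>

definition full_degree :: nat where
  "full_degree = (LEAST n. 1 \<le> n \<and> full n)"

lemma full_degree: "1 \<le> full_degree" "full full_degree"
  using LeastI[of "\<lambda>n. 1 \<le> n \<and> full n" "Suc \<alpha>"] full_Suc_alpha by (auto simp: full_degree_def)

lemma full_degree_le: "1 \<le> n \<Longrightarrow> full n \<Longrightarrow> full_degree \<le> n"
  unfolding full_degree_def by (rule Least_le) simp

text \<open>Beyond \<open>full_degree\<close>, the degree \<open>j - 1\<close> is full and
  \<open>j - 2\<close> is nonnegative, so the vanishing criterion applies. The bound is sharp
  because the first cohomology is nonzero in degree \<open>full_degree - 1\<close>.\<close>

lemma regularity_eq_full_degree:
  assumes "\<not> full 1"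
  shows "regularity TYPE('k::field) \<alpha> A = int full_degree"
  unfolding regularity_def
proof (rule Least_equality)
  show "\<forall>(i::nat) j. int full_degree < j \<longrightarrow>
      trivial_group (local_cohomology TYPE('k) \<alpha> A i (j - int i))"
  proof (intro allI impI)
    fix i :: nat and j assume j: "int full_degree < j"
    have "full (nat (j - 1))"
      using full_degree(2,1) by (rule full_mono) (use j in linarith)
    then show "trivial_group (local_cohomology TYPE('k) \<alpha> A i (j - int i))"
      using j full_degree(1) by (intro local_cohomology_trivial) auto
  qed
next
  fix n :: int
  assume n: "\<forall>(i::nat) j. n < j \<longrightarrow> trivial_group (local_cohomology TYPE('k) \<alpha> A i (j - int i))"
  show "int full_degree \<le> n"
  proof (rule ccontr)
    assume "\<not> int full_degree \<le> n"
    then have "trivial_group (local_cohomology TYPE('k) \<alpha> A 1 (int full_degree - int 1))"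
      using n by (meson not_le)
    \<comment> \<open>As degree \<open>1\<close> is not full, the preceding degree is still
      positive, so minimality of \<open>full_degree\<close> gives it a hole.\<close>
    moreover have "full_degree \<noteq> 1" using full_degree(2) assms by metis
    then have "2 \<le> full_degree" using full_degree(1) by linarith
    then have "\<not> full (full_degree - 1)"
      using full_degree_le[of "full_degree - 1"] by (intro notI) linarith
    from local_cohomology_nontrivial[OF this, where 'k = 'k]
    have "\<not> trivial_group (local_cohomology TYPE('k) \<alpha> A 1 (int full_degree - int 1))"
      using full_degree(1) by (simp add: of_nat_diff)
    ultimately show False by blast
  qed
qed

section \<open>Bounds for the reduction number\<close>

text \<open>Two copies of a full interval, shifted by \<open>0\<close> and \<open>\<alpha>\<close>,
  cover the whole range of the next degree.\<close>

lemma full_imp_reduction: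
  assumes "1 \<le> n" "full n"
  shows "sumset A (Suc n) \<subseteq> {0, \<alpha>} + sumset A n"
proof
  fix s assume "s \<in> sumset A (Suc n)"
  then have s: "s \<le> Suc n * \<alpha>" using subset by (intro sumset_le)
  show "s \<in> {0, \<alpha>} + sumset A n"
  proof (cases "s \<le> n * \<alpha>")
    case True
    with assms(2) have "0 + s \<in> {0, \<alpha>} + sumset A n"
      by (intro set_plus_intro) (auto simp: full_def)
    then show ?thesis by simp
  next
    case False
    have "1 * \<alpha> \<le> n * \<alpha>" using assms(1) by (intro mult_right_mono) auto
    with False have "\<alpha> \<le> s" by linarith
    moreover have "\<alpha> + (s - \<alpha>) \<in> {0, \<alpha>} + sumset A n"
      using assms(2) s by (intro set_plus_intro) (auto simp: full_def)
    ultimately show ?thesis by simp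
  qed
qed

text \<open>The full degree satisfies the reduction condition, so the least such number exists and
  is bounded by it.\<close>

lemma
  shows reduction_number_le_full_degree: "reduction_number TYPE('k::field) \<alpha> A \<le> full_degree"
    and reduction_number_reduces: "sumset A (Suc (reduction_number TYPE('k) \<alpha> A))
      \<subseteq> {0, \<alpha>} + sumset A (reduction_number TYPE('k) \<alpha> A)"
proof -
  have eq: "reduction_number TYPE('k) \<alpha> A = (LEAST r. sumset A (Suc r) \<subseteq> {0, \<alpha>} + sumset A r)"
    using alpha_pos ends by (intro reduction_number_eq) auto
  note red = full_imp_reduction[OF full_degree]
  show "reduction_number TYPE('k) \<alpha> A \<le> full_degree" unfolding eq using red by (rule Least_le)
  show "sumset A (Suc (reduction_number TYPE('k) \<alpha> A))
      \<subseteq> {0, \<alpha>} + sumset A (reduction_number TYPE('k) \<alpha> A)"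
    unfolding eq using red by (rule LeastI)
qed

text \<open>The obstruction is \<open>r * e + 1\<close>: it is a sum of \<open>r + 1\<close>
  elements of \<open>A\<close> since \<open>e \<ge> 1\<close>. If it were below
  \<open>q \<le> \<alpha>\<close>, the summand \<open>\<alpha>\<close> would be too large, while the
  \<open>r\<close>-fold sums below \<open>q\<close> reach only \<open>r * e\<close>.\<close>

lemma reduction_lower_bound:
  assumes red: "sumset A (Suc r) \<subseteq> {0, \<alpha>} + sumset A r"
    and e: "1 \<le> e" "{0..e} \<subseteq> A" and q: "q \<le> \<alpha>" "\<And>a. a \<in> A \<Longrightarrow> a < q \<Longrightarrow> a \<le> e"
  shows "q < r * e + 2"
proof (rule ccontr)
  assume "\<not> q < r * e + 2"
  then have lt: "r * e + 1 < q" by simp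
  have "r * e + 1 \<in> sumset A (Suc r)" using e by (intro sumset_low[of e]) auto
  with red have "r * e + 1 \<in> {0, \<alpha>} + sumset A r" by (rule subsetD)
  then obtain g t where "g \<in> {0, \<alpha>}" "t \<in> sumset A r" "r * e + 1 = g + t"
    by (auto elim!: set_plus_elim simp del: insert_iff)
  with lt q(1) have "r * e + 1 \<in> sumset A r" by auto
  then have "r * e + 1 \<le> r * e" using q(2) lt by (intro sumset_initial[of A q e])
  then show False by simp
qed

end

section \<open>Gaps\<close>

lemma poly_support_support_poly: "finite A \<Longrightarrow> poly_support (support_poly A) = A"
  by (simp add: poly_support_def support_poly_def coeff_sum)

text \<open>For \<open>y\<close> outside \<open>A\<close>, the nearest elements of \<open>A\<close>
  on either side enclose a gap containing \<open>y\<close>.\<close>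

lemma max_gap_cover:
  assumes A: "finite A" "0 \<in> A" "\<alpha> \<in> A" and y: "y \<le> \<alpha>"
  shows "\<exists>a\<in>A. a \<le> y \<and> y \<le> a + max_gap (support_poly A)"
proof (cases "y \<in> A")
  case False
  define a where "a = Max {x\<in>A. x \<le> y}"
  define b where "b = Min {x\<in>A. y \<le> x}"
  have a: "a \<in> A" "a \<le> y" "\<And>x. x \<in> A \<Longrightarrow> x \<le> y \<Longrightarrow> x \<le> a"
    using Max_in[of "{x\<in>A. x \<le> y}", folded a_def] Max_ge[of "{x\<in>A. x \<le> y}", folded a_def] A(1,2)
    by fastforce+
  have b: "b \<in> A" "y \<le> b" "\<And>x. x \<in> A \<Longrightarrow> y \<le> x \<Longrightarrow> b \<le> x"
    using Min_in[of "{x\<in>A. y \<le> x}", folded b_def] Min_le[of "{x\<in>A. y \<le> x}", folded b_def] A(1,3) y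
    by fastforce+
  have ayb: "a < y" "y < b" using a b False by (auto simp: le_less)
  have "is_gap (support_poly A) {a + 1..b - 1}"
    unfolding is_gap_def poly_support_support_poly[OF A(1)]
  proof (rule exI[of _ "a + 1"], rule exI[of _ "b - 1"], intro conjI)
    show "{a + 1..b - 1} \<inter> A = {}"
    proof safe
      fix x assume "x \<in> {a + 1..b - 1}" "x \<in> A"
      with a(3)[of x] b(3)[of x] ayb show "x \<in> {}" by (cases "x \<le> y") auto
    qed
  qed (use a b ayb in auto)
  \<comment> \<open>Every gap lies below \<open>Max A\<close>; finiteness makes the maximum in
    \<open>max_gap\<close> meaningful.\<close>
  moreover have "finite {card L | L. is_gap (support_poly A) L}"
  proof (rule finite_subset)
    show "{card L | L. is_gap (support_poly A) L} \<subseteq> card ` Pow {..Max A}"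
    proof safe
      fix L assume "is_gap (support_poly A) L"
      then obtain i j where "L = {i..j}" "j + 1 \<in> A"
        unfolding is_gap_def poly_support_support_poly[OF A(1)] by blast
      moreover from this have "j + 1 \<le> Max A" using A(1) by simp
      ultimately show "card L \<in> card ` Pow {..Max A}" by (intro imageI) auto
    qed
  qed simp
  ultimately have "card {a + 1..b - 1} \<le> max_gap (support_poly A)"
    unfolding max_gap_def by (intro Max_ge) auto
  with a ayb show ?thesis by (intro bexI[of _ a]) auto
qed (auto intro: exI)

section \<open>The inequalities and the symmetric case\<close>

theorem theorem3p8:
  fixes \<epsilon> l \<alpha> :: nat and p :: "nat \<Rightarrow> nat" and A :: "nat set"
  assumes "1 \<le> \<epsilon>" and "1 \<le> l"
    and "\<epsilon> + 2 \<le> p 1" and "strict_mono_on {1..l} p" and "p l + \<epsilon> \<le> \<alpha>"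
    and "A = {0..\<epsilon>} \<union> p ` {1..l} \<union> {\<alpha> - 1, \<alpha>}"
  shows "regularity TYPE('k::field) \<alpha> A \<ge> int (reduction_number TYPE('k) \<alpha> A)
       \<and> int (reduction_number TYPE('k) \<alpha> A) \<ge> \<lfloor>(real (p 1) - 2) / real \<epsilon>\<rfloor> + 1
       \<and> ((\<forall>i\<in>{0..\<epsilon>}. \<alpha> - i \<in> A)
            \<and> int (p 1) - int \<epsilon> - 1 = int (max_gap (support_poly A))
          \<longrightarrow> regularity TYPE('k) \<alpha> A = int (reduction_number TYPE('k) \<alpha> A)
            \<and> int (reduction_number TYPE('k) \<alpha> A)
                = \<lfloor>(real (max_gap (support_poly A)) - 1) / real \<epsilon>\<rfloor> + 2)"
proof -
  have p: "p 1 \<le> p i" "p i \<le> p l" if "i \<in> {1..l}" for i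
    using that assms(2,4) by (auto intro: strict_mono_on_leD[of "{1..l}" p])
  have p1: "p 1 + \<epsilon> \<le> \<alpha>" using p(2)[of 1] assms(2,5) by simp
  interpret monomial_curve \<alpha> A
  proof
    show "A \<subseteq> {..\<alpha>}" using p(2) assms(3,5) p1 by (fastforce simp: assms(6))
    show "{0, 1, \<alpha> - 1, \<alpha>} \<subseteq> A" using assms(1) by (simp add: assms(6))
    show "0 < \<alpha>" using p1 assms(3) by simp
  qed
  define r where "r = reduction_number TYPE('k) \<alpha> A"
  have initial: "a \<le> \<epsilon>" if "a \<in> A" "a < p 1" for a
    using that p(1) p1 assms(1) by (fastforce simp: assms(6))
  \<comment> \<open>The point \<open>\<epsilon> + 1\<close> is a hole in degree \<open>1\<close>,
    because \<open>p 1\<close> is at least \<open>\<epsilon> + 2\<close>.\<close>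
  have "\<epsilon> + 1 \<notin> A" using initial[of "\<epsilon> + 1"] assms(3) by auto
  moreover have "\<epsilon> + 1 \<in> {..\<alpha>}" using p1 assms(3) by simp
  ultimately have "\<not> full 1" unfolding full_def sumset_one One_nat_def mult_Suc by auto
  then have reg: "regularity TYPE('k) \<alpha> A = int full_degree" by (rule regularity_eq_full_degree)
  have le: "r \<le> full_degree" unfolding r_def by (rule reduction_number_le_full_degree)
  have "p 1 < r * \<epsilon> + 2"
    unfolding r_def
  proof (rule reduction_lower_bound[OF reduction_number_reduces assms(1)])
    show "{0..\<epsilon>} \<subseteq> A" by (auto simp: assms(6))
  qed (use p1 initial in auto)
  then have "real (p 1) < real (r * \<epsilon> + 2)" by (simp only: of_nat_less_iff)
  then have "(real (p 1) - 2) / real \<epsilon> < real r" using assms(1) by (simp add: field_simps)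
  then have lower: "\<lfloor>(real (p 1) - 2) / real \<epsilon>\<rfloor> + 1 \<le> int r" by linarith
  have "int full_degree = int r \<and> int r = \<lfloor>(real (max_gap (support_poly A)) - 1) / real \<epsilon>\<rfloor> + 2"
    if sym: "\<forall>i\<in>{0..\<epsilon>}. \<alpha> - i \<in> A"
      and gap: "int (p 1) - int \<epsilon> - 1 = int (max_gap (support_poly A))"
  proof -
    define g where "g = max_gap (support_poly A)"
    \<comment> \<open>The least number with \<open>g \<le> k * \<epsilon>\<close>, written with a
      floor to match the claim.\<close>
    define k where "k = nat (\<lfloor>(real g - 1) / real \<epsilon>\<rfloor> + 1)"
    have g: "p 1 = g + \<epsilon> + 1" "1 \<le> g" using gap assms(3) by (auto simp: g_def)
    \<comment> \<open>Since \<open>g \<ge> 1\<close>, the floor is nonnegative and the conversion by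
      \<open>nat\<close> loses nothing.\<close>
    have "0 \<le> (real g - 1) / real \<epsilon>" using g(2) by simp
    then have k: "int k = \<lfloor>(real g - 1) / real \<epsilon>\<rfloor> + 1" by (simp add: k_def)
    have "(real g - 1) / real \<epsilon> < real k" using k by linarith
    then have "real g < real (k * \<epsilon> + 1)" using assms(1) by (simp add: field_simps)
    then have "g < k * \<epsilon> + 1" by (simp only: of_nat_less_iff)
    then have "g \<le> k * \<epsilon>" by simp
    have "full (Suc k)"
      unfolding full_def
    proof (rule sumset_full_if_gaps_le[OF _ _ _ \<open>g \<le> k * \<epsilon>\<close>])
      show "\<exists>a\<in>A. a \<le> y \<and> y \<le> a + g" if "y \<le> \<alpha>" for y
        unfolding g_def using finite_A _ _ that by (rule max_gap_cover) (use ends in auto)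
    qed (use sym p1 in \<open>auto simp: assms(6)\<close>)
    then have "full_degree \<le> Suc k" by (intro full_degree_le) auto
    \<comment> \<open>Here \<open>p 1 - 2 = (g - 1) + \<epsilon>\<close>, so the general lower bound
      rises to \<open>k + 1\<close> and meets the upper bound from
      \<open>full_degree\<close>.\<close>
    moreover have "real (p 1) = real g + real \<epsilon> + 1" unfolding g(1) by simp
    then have "(real (p 1) - 2) / real \<epsilon> = (real g - 1) / real \<epsilon> + 1"
      using assms(1) by (simp add: field_simps)
    then have "int k + 1 \<le> int r" using lower k by simp
    ultimately show ?thesis using le k by (simp add: g_def)
  qed
  with le lower reg show ?thesis by (simp add: r_def)
qed

end
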